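(* Let $\mathcal{A}$ be the collection of random-scan Gibbs sampler transition kernels (as defined in the context, in any dimension $d$) that have finite mixing time and satisfy $\rho(\theta)>0$ for all $\theta\in\mathbb{R}^d$. Then there exists a universal constant $0<K<\infty$ such that, for all $0<\alpha<0.5$, there exist constants $0<c_\alpha<\infty$ and $0<c'_\alpha<\infty$ such that for all $\{g(x,1,\cdot)\}_{x\in X}\in\mathcal{A}$, $$c_\alpha\,T_m\le \ell_H^{(k)}(\alpha)\le c'_\alpha\left(1+\frac{t_L}{k}\right)$$ uniformly in $k\ge K d\log(t_L)$ ($k\in\mathbb{N}$), where $T_m$ is the mixing time of $G=(g_L^{(k)})_L$, $\ell_H^{(k)}(\alpha)$ is the maximum hitting time of $g_L^{(k)}$, and $t_L$ is the mixing time of $g_L$.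
   Context: Gibbs sampler: fix a distribution $\pi$ with continuous density $\rho>0$ on $X=\mathbb{R}^d$. For $x\in\mathbb{R}^d$, $i\in\{1,\dots,d\}$, $z\in\mathbb{R}$ let $$\rho_{x,i}(z)=\frac{\rho(x[1],\dots,x[i-1],z,x[i+1],\dots,x[d])}{\int\rho(x[1],\dots,x[i-1],y,x[i+1],\dots,x[d])\,dy}$$ be the $i$-th conditional density (assumed well defined) and $F_{x,i}$ its CDF. With $i_t$ i.i.d. uniform on $\{1,\dots,d\}$ and $U_t$ i.i.d. uniform on $[0,1]$ (independent sequences), started from $X_0=x$, set $X_{t+1}=(X_t[1],\dots,X_t[i_t-1],F^{-1}_{X_t,i_t}(U_t),X_t[i_t+1],\dots,X_t[d])$, and $g(x,t,A)=\mathbb{P}_x[X_t\in A]$. Its stationary distribution is $\pi$. For a kernel $h$: its lazy version is $h_L(x,1,A)=\frac12h(x,1,A)+\frac12\mathbf{1}_{x\in A}$; its $k$-skeleton is $h^{(k)}(x,t,A)=h(x,kt,A)$. Thus $g_L^{(k)}$ is the $k$-skeleton of $g_L$, and $G=(g_L^{(k)})_L$ is the lazy version of $g_L^{(k)}$. The mixing time of a kernel $h$ with stationary distribution $\mu$ is $\min\{t\ge0:\sup_x\|h(x,t,\cdot)-\mu\|\le\frac14\}$, with $\|\mu-\nu\|=\sup_A|\mu(A)-\nu(A)|$. The maximum hitting time of $h$ is $\sup\{\mathbb{E}_x(\tau_A):x\in X,\ A\text{ Borel},\ \mu(A)\ge\alpha\}$, where $\tau_A=\min\{t\in\mathbb{N}:X_t\in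 A\}$ ($0\in\mathbb{N}$) for the chain with kernel $h$ started at $x$. The constants $c_\alpha,c'_\alpha$ depend only on $\alpha$. *)

theory Defs
  imports "HOL-Probability.Probability"
begin

text \<open>
  The dimension is bound inside the statement, so \<open>\<real>\<^sup>d\<close> is the set of extensional functions
  \<open>{1..d} \<rightarrow>\<^sub>E UNIV\<close>.  The sigma-algebra of the product measure below is the Borel one.
\<close>

definition lebesgue_Rn :: "nat \<Rightarrow> (nat \<Rightarrow> real) measure" where
  "lebesgue_Rn d = (\<Pi>\<^sub>M i\<in>{1..d}. lborel)"


section \<open>Transition kernels\<close>

text \<open>\<open>h x t\<close> is the law at time \<open>t\<close> of the chain started at \<open>x\<close>.\<close>

type_synonym 'a kernel = "'a \<Rightarrow> nat \<Rightarrow> 'a measure"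

primrec iterate_kernel :: "'a measure \<Rightarrow> ('a \<Rightarrow> 'a measure) \<Rightarrow> 'a kernel" where
  "iterate_kernel M p x 0 = return M x"
| "iterate_kernel M p x (Suc t) = iterate_kernel M p x t \<bind> p"

definition lazy_kernel :: "'a measure \<Rightarrow> 'a kernel \<Rightarrow> 'a kernel" where
  "lazy_kernel M h =
    iterate_kernel M (\<lambda>x. measure_of (space M) (sets M)
      (\<lambda>A. emeasure (h x 1) A / 2 + indicator A x / 2))"

definition skeleton_kernel :: "nat \<Rightarrow> 'a kernel \<Rightarrow> 'a kernel" where
  "skeleton_kernel k h x t = h x (k * t)"

definition tv_dist :: "'a measure \<Rightarrow> 'a measure \<Rightarrow> real" where
  "tv_dist \<mu> \<nu> = (SUP A\<in>sets \<nu>. \<bar>measure \<mu> A - measure \<nu> A\<bar>)"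

text \<open>The infimum over an empty set of times is \<open>\<infinity>\<close>, both here and in \<open>hitting_time\<close>.\<close>

definition mixing_time :: "'a kernel \<Rightarrow> 'a measure \<Rightarrow> enat" where
  "mixing_time h \<mu> = Inf (enat ` {t. (SUP x\<in>space \<mu>. tv_dist (h x t) \<mu>) \<le> 1 / 4})"

text \<open>
  Law on trajectories of the chain with one-step kernel \<open>h _ 1\<close> started at \<open>x\<close>, from the
  Ionescu-Tulcea theorem: coordinate \<open>0\<close> is \<open>x\<close>, and given coordinates \<open>0, \<dots>, n\<close>, coordinate
  \<open>n + 1\<close> has law \<open>h (\<omega> n) 1\<close>.
\<close>

definition path_law :: "'a measure \<Rightarrow> 'a kernel \<Rightarrow> 'a \<Rightarrow> (nat \<Rightarrow> 'a) measure" where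
  "path_law M h x =
    projective_family.lim UNIV
      (Ionescu_Tulcea.CI
        (\<lambda>n \<omega>. case n of 0 \<Rightarrow> return M x | Suc m \<Rightarrow> h (\<omega> m) 1) (\<lambda>_. M))
      (\<lambda>_. M)"

definition hitting_time :: "'a set \<Rightarrow> (nat \<Rightarrow> 'a) \<Rightarrow> enat" where
  "hitting_time A \<omega> = Inf (enat ` {t. \<omega> t \<in> A})"

definition max_hitting_time :: "'a kernel \<Rightarrow> 'a measure \<Rightarrow> real \<Rightarrow> ennreal" where
  "max_hitting_time h \<mu> \<alpha> =
    (SUP (x, A) \<in> space \<mu> \<times> {A \<in> sets \<mu>. \<alpha> \<le> measure \<mu> A}.
      \<integral>\<^sup>+ \<omega>. ennreal_of_enat (hitting_time A \<omega>) \<partial>path_law \<mu> h x)"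


section \<open>The random-scan Gibbs sampler\<close>

definition target :: "nat \<Rightarrow> ((nat \<Rightarrow> real) \<Rightarrow> real) \<Rightarrow> (nat \<Rightarrow> real) measure" where
  "target d \<rho> = density (lebesgue_Rn d) (\<lambda>x. ennreal (\<rho> x))"

text \<open>
  Continuity refers to the product topology on \<open>nat \<Rightarrow> real\<close>, which on
  \<open>space (lebesgue_Rn d)\<close> induces the Euclidean topology of \<open>\<real>\<^sup>d\<close>.  The last condition is what
  makes every conditional density well defined.
\<close>

definition gibbs_density :: "nat \<Rightarrow> ((nat \<Rightarrow> real) \<Rightarrow> real) \<Rightarrow> bool" where
  "gibbs_density d \<rho> \<longleftrightarrow>
    d \<ge> 1 \<and>
    continuous_on (space (lebesgue_Rn d)) \<rho> \<and>
    (\<forall>x\<in>space (lebesgue_Rn d). \<rho> x > 0) \<and>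
    prob_space (target d \<rho>) \<and>
    (\<forall>x\<in>space (lebesgue_Rn d). \<forall>i\<in>{1..d}. integrable lborel (\<lambda>y. \<rho> (x(i := y))))"

definition cond_density :: "((nat \<Rightarrow> real) \<Rightarrow> real) \<Rightarrow> (nat \<Rightarrow> real) \<Rightarrow> nat \<Rightarrow> real \<Rightarrow> real" where
  "cond_density \<rho> x i z = \<rho> (x(i := z)) / (\<integral>y. \<rho> (x(i := y)) \<partial>lborel)"

definition cond_cdf :: "((nat \<Rightarrow> real) \<Rightarrow> real) \<Rightarrow> (nat \<Rightarrow> real) \<Rightarrow> nat \<Rightarrow> real \<Rightarrow> real" where
  "cond_cdf \<rho> x i = cdf (density lborel (\<lambda>z. ennreal (cond_density \<rho> x i z)))"

text \<open>
  Since \<open>\<rho> > 0\<close>, \<open>cond_cdf \<rho> x i\<close> is a bijection from the reals onto the open unit interval.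
  At \<open>0\<close> and \<open>1\<close>, a null event for the uniform variable, \<open>inv\<close> takes an unspecified value.
\<close>

primrec gibbs_chain ::
  "((nat \<Rightarrow> real) \<Rightarrow> real) \<Rightarrow> (nat \<Rightarrow> nat) \<Rightarrow> (nat \<Rightarrow> real) \<Rightarrow> (nat \<Rightarrow> real) \<Rightarrow> nat \<Rightarrow> (nat \<Rightarrow> real)"
where
  "gibbs_chain \<rho> I U x 0 = x"
| "gibbs_chain \<rho> I U x (Suc t) =
    (let y = gibbs_chain \<rho> I U x t in y(I t := inv (cond_cdf \<rho> y (I t)) (U t)))"

definition gibbs_noise :: "nat \<Rightarrow> ((nat \<Rightarrow> nat) \<times> (nat \<Rightarrow> real)) measure" where
  "gibbs_noise d =
    (\<Pi>\<^sub>M t\<in>UNIV. uniform_count_measure {1..d}) \<Otimes>\<^sub>M (\<Pi>\<^sub>M t\<in>UNIV. uniform_measure lborel {0..1})"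

definition gibbs_kernel :: "nat \<Rightarrow> ((nat \<Rightarrow> real) \<Rightarrow> real) \<Rightarrow> (nat \<Rightarrow> real) kernel" where
  "gibbs_kernel d \<rho> x t =
    distr (gibbs_noise d) (lebesgue_Rn d) (\<lambda>(I, U). gibbs_chain \<rho> I U x t)"

end

theory Submission
  imports Defs
begin

text \<open>
  The lower bound holds for every reversible kernel \<open>p\<close>, here the skeleton. Let \<open>H \<ge> 1\<close> bound the
  expected hitting times \<open>h\<close> of sets of measure at least \<open>1 / 2\<close>. As \<open>K h = h - 1\<close> off \<open>A\<close>, the
  function \<open>h\<close> is a supersolution and a function \<open>f\<close> vanishing on \<open>A\<close> satisfies
  \<open>\<langle>f, K f\<rangle> \<le> (1 - 1 / H) \<langle>f, f\<rangle>\<close>; splitting a function at its median turns this into a spectral gap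
  \<open>1 / H\<close>. The lazy operator \<open>L = (I + K) / 2\<close> is moreover positive, whence
  \<open>\<Sum>\<^sub>k (2 k + 1) \<parallel>L\<^sup>k f - L\<^sup>k\<^sup>+\<^sup>1 f\<parallel>\<^sup>2 \<le> \<parallel>f\<parallel>\<^sup>2\<close>. Starting from \<open>f = L\<^sup>r (1\<^sub>A - \<mu>(A))\<close>, whose norm
  is small for \<open>r\<close> of order \<open>H\<close>, all of \<open>L\<^sup>k f\<close> with \<open>k\<close> in a window of length of order \<open>H\<close> are therefore small
  simultaneously on a set of measure at least \<open>1 / 2\<close>; the lazy chain hits that set within the window
  with probability at least \<open>7 / 8\<close>, and this bounds the distance to stationarity.

  For the upper bound, being within \<open>1 / 4\<close> of stationarity at time \<open>t\<close> contracts oscillations by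
  \<open>7 / 8\<close>, so after a multiple of \<open>t\<close> depending only on \<open>\<alpha>\<close> every set of measure at least \<open>\<alpha>\<close> is charged with
  probability at least \<open>\<alpha> / 2\<close> from every starting point.
\<close>

section \<open>Bounded measurable functions\<close>

text \<open>The obstacle in the lower bound is the passage from L2 to every starting point: a
  spectral gap makes iterates small in L2, which says nothing at a fixed \<open>x\<close>. Hitting
  times, however, are bounded from every \<open>x\<close>, so the chain can be run until it enters a
  set where the function is small. The entrance time is random, so smallness must hold at all
  remaining times at once, and Chebyshev at one time is replaced by a maximal inequality. The
  weights \<open>2 k + 1\<close> provide it. Positivity of \<open>L\<close> makes
  \<open>ip (L^j f) f\<close> a decreasing convex sequence in \<open>j\<close>, as for moments of a
  measure on [0, 1], and weighted second differences of such a sequence telescope; this is where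
  laziness enters. The spectral theorem is replaced throughout by explicit identities for the
  quadratic forms of \<open>K\<close> and \<open>L\<close>, and the gap comes from a Barta-type
  comparison of \<open>f^2 / h\<close> with \<open>h\<close>. Bounded measurable functions stand in
  for L2 classes: they have values at points, every integral of them exists, and they are stable
  under products and under \<open>K\<close>.\<close>

definition bounded_measurable :: "'a measure \<Rightarrow> ('a \<Rightarrow> real) set" where
  "bounded_measurable M = {f \<in> borel_measurable M. \<exists>C. \<forall>x\<in>space M. \<bar>f x\<bar> \<le> C}"

lemma bounded_measurableI:
  "f \<in> borel_measurable M \<Longrightarrow> (\<And>x. x \<in> space M \<Longrightarrow> \<bar>f x\<bar> \<le> C) \<Longrightarrow> f \<in> bounded_measurable M"
  unfolding bounded_measurable_def by blast

lemma bounded_measurableD [measurable_dest]: "f \<in> bounded_measurable M \<Longrightarrow> f \<in> borel_measurable M"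
  unfolding bounded_measurable_def by blast

lemma bounded_measurableE:
  assumes "f \<in> bounded_measurable M"
  obtains C where "0 \<le> C" "\<And>x. x \<in> space M \<Longrightarrow> \<bar>f x\<bar> \<le> C"
proof -
  obtain C where "\<And>x. x \<in> space M \<Longrightarrow> \<bar>f x\<bar> \<le> C"
    using assms unfolding bounded_measurable_def by blast
  then show thesis by (intro that[of "max 0 C"]) (auto simp: max.coboundedI2)
qed

named_theorems bm_intros

lemma bounded_measurable_const [bm_intros]: "(\<lambda>x. c) \<in> bounded_measurable M"
  by (rule bounded_measurableI[of _ _ "\<bar>c\<bar>"]) auto

lemma bounded_measurable_indicator [bm_intros]:
  "A \<in> sets M \<Longrightarrow> indicator A \<in> bounded_measurable M"
  by (rule bounded_measurableI[of _ _ 1]) (auto simp: indicator_def)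

lemma bounded_measurable_add [bm_intros]:
  assumes "f \<in> bounded_measurable M" "g \<in> bounded_measurable M"
  shows "(\<lambda>x. f x + g x) \<in> bounded_measurable M"
proof -
  obtain C D where "\<And>x. x \<in> space M \<Longrightarrow> \<bar>f x\<bar> \<le> C" "\<And>x. x \<in> space M \<Longrightarrow> \<bar>g x\<bar> \<le> D"
    using assms by (metis bounded_measurableE)
  then show ?thesis
    using assms by (intro bounded_measurableI[of _ _ "C + D"]) (auto, fastforce intro: order_trans[OF abs_triangle_ineq] add_mono)
qed

lemma bounded_measurable_mult [bm_intros]:
  assumes "f \<in> bounded_measurable M" "g \<in> bounded_measurable M"
  shows "(\<lambda>x. f x * g x) \<in> bounded_measurable M"
proof -
  obtain C D where "0 \<le> C" "\<And>x. x \<in> space M \<Longrightarrow> \<bar>f x\<bar> \<le> C" "\<And>x. x \<in> space M \<Longrightarrow> \<bar>g x\<bar> \<le> D"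
    using assms by (metis bounded_measurableE)
  then show ?thesis
    using assms by (intro bounded_measurableI[of _ _ "C * D"]) (auto simp: abs_mult intro!: mult_mono)
qed

lemma bounded_measurable_diff [bm_intros]:
  assumes "f \<in> bounded_measurable M" "g \<in> bounded_measurable M"
  shows "(\<lambda>x. f x - g x) \<in> bounded_measurable M"
  using bounded_measurable_add[OF assms(1) bounded_measurable_mult[OF bounded_measurable_const[of "-1"] assms(2)]]
  by simp

lemma bounded_measurable_divide_const [bm_intros]:
  "f \<in> bounded_measurable M \<Longrightarrow> (\<lambda>x. f x / c) \<in> bounded_measurable M"
  using bounded_measurable_mult[OF bounded_measurable_const[of "1 / c"]] by simp

lemma bounded_measurable_power2 [bm_intros]:
  "f \<in> bounded_measurable M \<Longrightarrow> (\<lambda>x. (f x)\<^sup>2) \<in> bounded_measurable M"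
  unfolding power2_eq_square by (rule bounded_measurable_mult)

lemma bounded_measurable_max0 [bm_intros]:
  assumes "f \<in> bounded_measurable M"
  shows "(\<lambda>x. max 0 (f x)) \<in> bounded_measurable M"
proof -
  obtain C where "0 \<le> C" "\<And>x. x \<in> space M \<Longrightarrow> \<bar>f x\<bar> \<le> C"
    using assms by (metis bounded_measurableE)
  then show ?thesis
    using assms by (intro bounded_measurableI[of _ _ C]) (auto simp: max_def abs_le_iff)
qed

lemma bounded_measurable_abs [bm_intros]:
  assumes "f \<in> bounded_measurable M"
  shows "(\<lambda>x. \<bar>f x\<bar>) \<in> bounded_measurable M"
proof -
  obtain C where "0 \<le> C" "\<And>x. x \<in> space M \<Longrightarrow> \<bar>f x\<bar> \<le> C"
    using assms by (metis bounded_measurableE)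
  then show ?thesis
    using assms by (intro bounded_measurableI[of _ _ C]) auto
qed

lemma bounded_measurable_sum [bm_intros]:
  "(\<And>i. i \<in> I \<Longrightarrow> f i \<in> bounded_measurable M) \<Longrightarrow> (\<lambda>x. \<Sum>i\<in>I. f i x) \<in> bounded_measurable M"
  by (induction I rule: infinite_finite_induct) (auto intro: bm_intros)

lemma (in finite_measure) bounded_measurable_integrable:
  assumes "f \<in> bounded_measurable M"
  shows "integrable M f"
proof -
  obtain C where "\<And>x. x \<in> space M \<Longrightarrow> \<bar>f x\<bar> \<le> C"
    using assms by (metis bounded_measurableE)
  then show ?thesis
    using assms by (intro integrable_const_bound[of f C]) auto
qed

lemma bounded_measurable_cong_sets: "sets M = sets N \<Longrightarrow> bounded_measurable M = bounded_measurable N"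
  unfolding bounded_measurable_def
  by (metis (no_types, lifting) measurable_cong_sets sets_eq_imp_space_eq)

section \<open>Markov operators\<close>

text \<open>Cutting the operator off outside of \<open>space M\<close> makes it linear as an identity of functions.\<close>

definition markov_op :: "'a measure \<Rightarrow> ('a \<Rightarrow> 'a measure) \<Rightarrow> ('a \<Rightarrow> real) \<Rightarrow> 'a \<Rightarrow> real" where
  "markov_op M p f x = (if x \<in> space M then (\<integral>y. f y \<partial>p x) else 0)"

locale markov_kernel = prob_space M for M :: "'a measure" +
  fixes p :: "'a \<Rightarrow> 'a measure"
  assumes kernel: "p \<in> M \<rightarrow>\<^sub>M prob_algebra M"
begin

abbreviation "K \<equiv> markov_op M p"

lemma kernel_subprob [measurable]: "p \<in> M \<rightarrow>\<^sub>M subprob_algebra M"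
  using kernel by (rule measurable_prob_algebraD)

lemma prob_space_kernel: "x \<in> space M \<Longrightarrow> prob_space (p x)"
  using measurable_space[OF kernel] by (auto simp: space_prob_algebra)

lemma sets_kernel: "x \<in> space M \<Longrightarrow> sets (p x) = sets M"
  using measurable_space[OF kernel] by (auto simp: space_prob_algebra)

lemma space_kernel: "x \<in> space M \<Longrightarrow> space (p x) = space M"
  by (rule sets_eq_imp_space_eq[OF sets_kernel])

lemma bounded_measurable_kernel:
  "x \<in> space M \<Longrightarrow> f \<in> bounded_measurable M \<Longrightarrow> f \<in> bounded_measurable (p x)"
  using bounded_measurable_cong_sets[OF sets_kernel] by blast

lemma integrable_kernel:
  assumes "x \<in> space M" "f \<in> bounded_measurable M"
  shows "integrable (p x) f"
proof -
  interpret p: prob_space "p x" using assms(1) by (rule prob_space_kernel)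
  show ?thesis by (rule p.bounded_measurable_integrable[OF bounded_measurable_kernel[OF assms]])
qed

lemma markov_op_mono:
  assumes "x \<in> space M" "f \<in> bounded_measurable M" "g \<in> bounded_measurable M"
    "\<And>y. y \<in> space M \<Longrightarrow> f y \<le> g y"
  shows "K f x \<le> K g x"
  using assms by (auto simp: markov_op_def space_kernel intro!: integral_mono integrable_kernel)

lemma markov_op_const: "x \<in> space M \<Longrightarrow> K (\<lambda>_. c) x = c"
  using prob_space.prob_space[OF prob_space_kernel, of x] by (simp add: markov_op_def)

lemma markov_op_bounds:
  assumes "x \<in> space M" "f \<in> bounded_measurable M" "\<And>y. y \<in> space M \<Longrightarrow> a \<le> f y \<and> f y \<le> b"
  shows "a \<le> K f x" "K f x \<le> b"
  using markov_op_mono[OF assms(1) bounded_measurable_const assms(2), of a]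
    markov_op_mono[OF assms(1,2) bounded_measurable_const, of b] assms(1,3)
  by (auto simp: markov_op_const)

lemma markov_op_nonneg:
  assumes "\<And>y. y \<in> space M \<Longrightarrow> 0 \<le> f y"
  shows "0 \<le> K f x"
  using assms by (auto simp: markov_op_def space_kernel intro!: integral_nonneg_AE)

lemma bounded_measurable_markov_op [bm_intros]:
  assumes "f \<in> bounded_measurable M"
  shows "K f \<in> bounded_measurable M"
proof -
  obtain C where C: "\<And>x. x \<in> space M \<Longrightarrow> \<bar>f x\<bar> \<le> C"
    using assms by (metis bounded_measurableE)
  have [measurable]: "f \<in> borel_measurable M" using assms by auto
  have "(\<lambda>x. \<integral>y. f y \<partial>p x) \<in> borel_measurable M"
    by (rule measurable_compose[OF kernel_subprob integral_measurable_subprob_algebra]) simp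
  then have "K f \<in> borel_measurable M"
    by (subst measurable_cong[of _ _ "\<lambda>x. \<integral>y. f y \<partial>p x"]) (auto simp: markov_op_def)
  moreover have "\<bar>K f x\<bar> \<le> C" if "x \<in> space M" for x
    using markov_op_bounds[OF that assms, of "-C" C] C by (auto simp: abs_le_iff minus_le_iff)
  ultimately show ?thesis by (rule bounded_measurableI)
qed

lemma markov_op_add:
  assumes "f \<in> bounded_measurable M" "g \<in> bounded_measurable M"
  shows "K (\<lambda>x. f x + g x) = (\<lambda>x. K f x + K g x)"
  using assms by (auto simp: markov_op_def integrable_kernel)

lemma markov_op_diff:
  assumes "f \<in> bounded_measurable M" "g \<in> bounded_measurable M"
  shows "K (\<lambda>x. f x - g x) = (\<lambda>x. K f x - K g x)"
  using assms by (auto simp: markov_op_def integrable_kernel)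

lemma markov_op_cmult: "K (\<lambda>x. c * f x) = (\<lambda>x. c * K f x)"
  by (auto simp: markov_op_def)

lemma markov_op_divide: "K (\<lambda>x. f x / c) = (\<lambda>x. K f x / c)"
  by (auto simp: markov_op_def)

lemma markov_op_cong: "(\<And>x. x \<in> space M \<Longrightarrow> f x = g x) \<Longrightarrow> K f = K g"
  unfolding markov_op_def
  by (auto simp: fun_eq_iff space_kernel intro!: Bochner_Integration.integral_cong)

lemma markov_op_abs:
  assumes "x \<in> space M" "f \<in> bounded_measurable M"
  shows "\<bar>K f x\<bar> \<le> K (\<lambda>y. \<bar>f y\<bar>) x"
  using assms by (simp add: markov_op_def integral_abs_bound)

text \<open>Jensen's inequality, in the form that the variance of \<open>f\<close> under
  \<open>p x\<close> is nonnegative.\<close>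

lemma markov_op_square:
  assumes "x \<in> space M" "f \<in> bounded_measurable M"
  shows "(K f x)\<^sup>2 \<le> K (\<lambda>y. (f y)\<^sup>2) x"
proof -
  interpret p: prob_space "p x" using assms(1) by (rule prob_space_kernel)
  have "integrable (p x) f" "integrable (p x) (\<lambda>y. (f y)\<^sup>2)"
    using assms by (auto intro!: integrable_kernel bm_intros)
  then have "0 \<le> p.expectation (\<lambda>y. (f y)\<^sup>2) - (p.expectation f)\<^sup>2"
    by (subst p.variance_eq[symmetric]) (auto intro: p.variance_positive)
  then show ?thesis using assms(1) by (simp add: markov_op_def)
qed

end

section \<open>Reversibility and the quadratic form of the Markov operator\<close>

locale reversible_kernel = markov_kernel +
  assumes reversible: "\<And>f g :: 'a \<Rightarrow> ennreal. f \<in> borel_measurable M \<Longrightarrow> g \<in> borel_measurable M \<Longrightarrow>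
    (\<integral>\<^sup>+x. f x * (\<integral>\<^sup>+y. g y \<partial>p x) \<partial>M) = (\<integral>\<^sup>+x. g x * (\<integral>\<^sup>+y. f y \<partial>p x) \<partial>M)"
begin

definition ip :: "('a \<Rightarrow> real) \<Rightarrow> ('a \<Rightarrow> real) \<Rightarrow> real" where
  "ip f g = (\<integral>x. f x * g x \<partial>M)"

lemma ip_commute: "ip f g = ip g f"
  by (simp add: ip_def mult.commute)

lemma ip_integrable:
  assumes "f \<in> bounded_measurable M" "g \<in> bounded_measurable M"
  shows "integrable M (\<lambda>x. f x * g x)"
  by (intro bounded_measurable_integrable bm_intros assms)

lemma ip_add_left:
  assumes "f \<in> bounded_measurable M" "g \<in> bounded_measurable M" "h \<in> bounded_measurable M"
  shows "ip (\<lambda>x. f x + g x) h = ip f h + ip g h"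
  by (simp add: ip_def ring_distribs ip_integrable assms)

lemma ip_diff_left:
  assumes "f \<in> bounded_measurable M" "g \<in> bounded_measurable M" "h \<in> bounded_measurable M"
  shows "ip (\<lambda>x. f x - g x) h = ip f h - ip g h"
  by (simp add: ip_def left_diff_distrib ip_integrable assms)

lemma ip_divide_left: "ip (\<lambda>x. f x / c) h = ip f h / c"
  by (simp add: ip_def)

lemma ip_add_right:
  assumes "f \<in> bounded_measurable M" "g \<in> bounded_measurable M" "h \<in> bounded_measurable M"
  shows "ip h (\<lambda>x. f x + g x) = ip h f + ip h g"
  by (subst (1 2 3) ip_commute) (rule ip_add_left[OF assms])

lemma ip_diff_right:
  assumes "f \<in> bounded_measurable M" "g \<in> bounded_measurable M" "h \<in> bounded_measurable M"
  shows "ip h (\<lambda>x. f x - g x) = ip h f - ip h g"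
  by (subst (1 2 3) ip_commute) (rule ip_diff_left[OF assms])

lemma ip_divide_right: "ip h (\<lambda>x. f x / c) = ip h f / c"
  by (simp add: ip_def)

lemmas ip_simps = ip_add_left ip_diff_left ip_divide_left ip_add_right ip_diff_right ip_divide_right

lemma ip_self_nonneg: "0 \<le> ip f f"
  unfolding ip_def by (rule integral_nonneg_AE) auto

text \<open>The locale states symmetry for extended nonnegative integrals, which needs no
  integrability; it carries over to Bochner integrals directly for nonnegative functions only.
  Signed functions are reached below by adding constants.\<close>

lemma markov_op_symmetric_nonneg:
  assumes f: "f \<in> bounded_measurable M" and g: "g \<in> bounded_measurable M"
    and nn: "\<And>x. x \<in> space M \<Longrightarrow> 0 \<le> f x" "\<And>x. x \<in> space M \<Longrightarrow> 0 \<le> g x"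
  shows "ip f (K g) = ip g (K f)"
proof -
  have *: "ennreal (ip f (K g)) = (\<integral>\<^sup>+x. ennreal (f x) * (\<integral>\<^sup>+y. ennreal (g y) \<partial>p x) \<partial>M)"
    if f: "f \<in> bounded_measurable M" and g: "g \<in> bounded_measurable M"
    and nn: "\<And>x. x \<in> space M \<Longrightarrow> 0 \<le> f x" "\<And>x. x \<in> space M \<Longrightarrow> 0 \<le> g x" for f g
  proof -
    have "ennreal (ip f (K g)) = (\<integral>\<^sup>+x. ennreal (f x * K g x) \<partial>M)"
      unfolding ip_def using f g nn
      by (intro nn_integral_eq_integral[symmetric] ip_integrable bm_intros AE_I2)
         (auto intro!: mult_nonneg_nonneg markov_op_nonneg)
    also have "\<dots> = (\<integral>\<^sup>+x. ennreal (f x) * (\<integral>\<^sup>+y. ennreal (g y) \<partial>p x) \<partial>M)"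
    proof (rule nn_integral_cong)
      fix x assume x: "x \<in> space M"
      have "ennreal (K g x) = (\<integral>\<^sup>+y. ennreal (g y) \<partial>p x)"
        unfolding markov_op_def using x g nn
        by (auto intro!: nn_integral_eq_integral[symmetric] integrable_kernel AE_I2 simp: space_kernel)
      then show "ennreal (f x * K g x) = ennreal (f x) * (\<integral>\<^sup>+y. ennreal (g y) \<partial>p x)"
        using x nn by (simp add: ennreal_mult' )
    qed
    finally show ?thesis .
  qed
  have "ennreal (ip f (K g)) = ennreal (ip g (K f))"
    using *[OF f g nn] *[OF g f nn(2,1)] reversible[of "\<lambda>x. ennreal (f x)" "\<lambda>x. ennreal (g x)"] f g by simp
  moreover have "0 \<le> ip f (K g)" "0 \<le> ip g (K f)"
    unfolding ip_def using nn by (auto intro!: integral_nonneg_AE AE_I2 mult_nonneg_nonneg markov_op_nonneg)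
  ultimately show ?thesis by simp
qed

text \<open>Stationarity of \<open>M\<close> is symmetry tested against the constant 1, which
  \<open>K\<close> fixes.\<close>

lemma integral_markov_op_nonneg:
  assumes f: "f \<in> bounded_measurable M" and nn: "\<And>x. x \<in> space M \<Longrightarrow> 0 \<le> f x"
  shows "(\<integral>x. K f x \<partial>M) = (\<integral>x. f x \<partial>M)"
proof -
  have "ip (\<lambda>_. 1) (K f) = ip f (K (\<lambda>_. 1))"
    by (rule markov_op_symmetric_nonneg) (auto intro: bm_intros f nn)
  also have "\<dots> = (\<integral>x. f x \<partial>M)"
    unfolding ip_def by (rule Bochner_Integration.integral_cong) (auto simp: markov_op_const)
  finally show ?thesis by (simp add: ip_def)
qed

lemma integral_markov_op:
  assumes f: "f \<in> bounded_measurable M"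
  shows "(\<integral>x. K f x \<partial>M) = (\<integral>x. f x \<partial>M)"
proof -
  obtain C where C: "0 \<le> C" "\<And>x. x \<in> space M \<Longrightarrow> \<bar>f x\<bar> \<le> C" using f by (metis bounded_measurableE)
  have "(\<integral>x. K (\<lambda>x. f x + C) x \<partial>M) = (\<integral>x. f x + C \<partial>M)"
    using C(2) by (intro integral_markov_op_nonneg bm_intros f) (smt (verit))
  moreover have "(\<integral>x. K (\<lambda>x. f x + C) x \<partial>M) = (\<integral>x. K f x + C \<partial>M)"
    by (intro Bochner_Integration.integral_cong)
       (auto simp: markov_op_add f bounded_measurable_const markov_op_const)
  moreover have "integrable M f" "integrable M (K f)"
    by (auto intro!: bounded_measurable_integrable bm_intros f)
  ultimately show ?thesis by simp
qed

text \<open>Shifting by \<open>C\<close> and \<open>D\<close> makes both functions nonnegative.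
  Since \<open>K\<close> preserves means, the shifts contribute the same three extra terms on both
  sides and cancel.\<close>

lemma markov_op_symmetric:
  assumes f: "f \<in> bounded_measurable M" and g: "g \<in> bounded_measurable M"
  shows "ip f (K g) = ip g (K f)"
proof -
  obtain C where C: "0 \<le> C" "\<And>x. x \<in> space M \<Longrightarrow> \<bar>f x\<bar> \<le> C" using f by (metis bounded_measurableE)
  obtain D where D: "0 \<le> D" "\<And>x. x \<in> space M \<Longrightarrow> \<bar>g x\<bar> \<le> D" using g by (metis bounded_measurableE)
  have *: "ip (\<lambda>x. f x + C) (K (\<lambda>x. g x + D)) = ip f (K g) + D * (\<integral>x. f x \<partial>M) + C * (\<integral>x. g x \<partial>M) + C * D"
    if f: "f \<in> bounded_measurable M" and g: "g \<in> bounded_measurable M" for f g C D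
  proof -
    have "ip (\<lambda>x. f x + C) (K (\<lambda>x. g x + D)) = (\<integral>x. f x * K g x + D * f x + C * K g x + C * D \<partial>M)"
      unfolding ip_def
      by (intro Bochner_Integration.integral_cong)
         (auto simp: markov_op_add g bounded_measurable_const markov_op_const algebra_simps)
    also have "\<dots> = ip f (K g) + D * (\<integral>x. f x \<partial>M) + C * (\<integral>x. K g x \<partial>M) + C * D"
    proof -
      have "integrable M f" "integrable M (K g)" "integrable M (\<lambda>x. f x * K g x)"
        by (auto intro!: bounded_measurable_integrable bm_intros f g)
      then show ?thesis by (simp add: ip_def prob_space)
    qed
    finally show ?thesis by (simp add: integral_markov_op g)
  qed
  have "ip (\<lambda>x. f x + C) (K (\<lambda>x. g x + D)) = ip (\<lambda>x. g x + D) (K (\<lambda>x. f x + C))"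
    by (intro markov_op_symmetric_nonneg bm_intros f g) (smt (verit) C D)+
  then show ?thesis unfolding *[OF f g] *[OF g f] by simp
qed

text \<open>Jensen pointwise, then stationarity.\<close>

lemma markov_op_contraction:
  assumes f: "f \<in> bounded_measurable M"
  shows "ip (K f) (K f) \<le> ip f f"
proof -
  have "ip (K f) (K f) \<le> (\<integral>x. K (\<lambda>y. (f y)\<^sup>2) x \<partial>M)"
    unfolding ip_def power2_eq_square[symmetric]
    by (intro integral_mono bounded_measurable_integrable bm_intros f markov_op_square) auto
  also have "\<dots> = ip f f"
    by (simp add: integral_markov_op bm_intros f ip_def power2_eq_square)
  finally show ?thesis .
qed

end

section \<open>Relaxation of the lazy operator\<close>

text \<open>Summation by parts; \<open>a\<close> will be the sequence of moments of
  \<open>L\<close>.\<close>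

lemma second_difference_sum:
  fixes a :: "nat \<Rightarrow> real"
  assumes "\<And>j. 0 \<le> a j" "\<And>j. a (Suc j) \<le> a j"
  shows "(\<Sum>j<n. real (Suc j) * (a j - 2 * a (Suc j) + a (Suc (Suc j)))) \<le> a 0"
proof -
  have "(\<Sum>j<n. real (Suc j) * (a j - 2 * a (Suc j) + a (Suc (Suc j)))) = a 0 - a n - n * (a n - a (Suc n))"
    by (induction n) (auto simp: algebra_simps)
  also have "\<dots> \<le> a 0"
    using assms(1)[of n] mult_nonneg_nonneg[of "real n" "a n - a (Suc n)"] assms(2)[of n] by linarith
  finally show ?thesis .
qed

lemma (in prob_space) median_exists:
  assumes [measurable]: "f \<in> borel_measurable M"
  obtains m :: real where "1 / 2 \<le> prob {x \<in> space M. f x \<le> m}" "1 / 2 \<le> prob {x \<in> space M. m \<le> f x}"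
proof -
  interpret N: real_distribution "distr M borel f" by (rule real_distribution_distr) simp
  interpret C: cdf_distribution "distr M borel f" by unfold_locales
  define m where "m = C.I (1 / 2)"
  have pseudo: "1 / 2 \<le> cdf (distr M borel f) x \<longleftrightarrow> m \<le> x" for x
    unfolding m_def by (rule C.pseudoinverse) auto
  have "1 / 2 \<le> prob {x \<in> space M. f x \<le> m}"
    using pseudo[of m] by (simp add: cdf_def measure_distr vimage_def Int_def conj_commute)
  \<comment> \<open>The mass strictly below \<open>m\<close> is the left limit of the distribution
    function at \<open>m\<close>, and to the left of \<open>m\<close> that function stays below 1/2
    by the choice of \<open>m\<close> as generalized inverse.\<close>
  moreover have "measure (distr M borel f) {..<m} \<le> 1 / 2"
  proof (rule tendsto_upperbound)
    show "(cdf (distr M borel f) \<longlongrightarrow> measure (distr M borel f) {..<m}) (at_left m)"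
      by (rule N.cdf_at_left)
    show "\<forall>\<^sub>F x in at_left m. cdf (distr M borel f) x \<le> 1 / 2"
      unfolding eventually_at_left_field using pseudo by (metis lt_ex linorder_not_le nle_le)
  qed simp
  then have "prob {x \<in> space M. f x < m} \<le> 1 / 2"
    by (simp add: measure_distr vimage_def Int_def conj_commute)
  moreover have "prob {x \<in> space M. m \<le> f x} = 1 - prob {x \<in> space M. f x < m}"
    by (subst prob_compl[symmetric]) (auto intro!: arg_cong[where f = prob])
  ultimately show thesis by (intro that) auto
qed

section \<open>The lazy operator as a positive contraction\<close>

context reversible_kernel
begin

definition L :: "('a \<Rightarrow> real) \<Rightarrow> 'a \<Rightarrow> real" where
  "L f x = (f x + K f x) / 2"

lemma L_eq: "L f = (\<lambda>x. (f x + K f x) / 2)"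
  by (simp add: L_def fun_eq_iff)

lemma bounded_measurable_L [bm_intros]: "f \<in> bounded_measurable M \<Longrightarrow> L f \<in> bounded_measurable M"
  unfolding L_eq by (intro bm_intros)

lemma bounded_measurable_L_pow [bm_intros]:
  "f \<in> bounded_measurable M \<Longrightarrow> (L ^^ n) f \<in> bounded_measurable M"
  by (induction n) (auto intro: bm_intros)

lemma L_diff:
  assumes "f \<in> bounded_measurable M" "g \<in> bounded_measurable M"
  shows "L (\<lambda>x. f x - g x) = (\<lambda>x. L f x - L g x)"
  by (simp add: L_eq markov_op_diff assms diff_divide_distrib add_divide_distrib algebra_simps)

lemma L_mono:
  assumes "x \<in> space M" "f \<in> bounded_measurable M" "g \<in> bounded_measurable M"
    "\<And>y. y \<in> space M \<Longrightarrow> f y \<le> g y"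
  shows "L f x \<le> L g x"
  unfolding L_def using markov_op_mono[OF assms] assms(4)[OF assms(1)] by simp

lemma L_abs:
  assumes "x \<in> space M" "f \<in> bounded_measurable M"
  shows "\<bar>L f x\<bar> \<le> L (\<lambda>y. \<bar>f y\<bar>) x"
  unfolding L_def using markov_op_abs[OF assms] abs_triangle_ineq[of "f x" "K f x"] by simp

lemma L_const: "x \<in> space M \<Longrightarrow> L (\<lambda>_. c) x = c"
  by (simp add: L_def markov_op_const)

lemma L_nonneg: "(\<And>y. y \<in> space M \<Longrightarrow> 0 \<le> f y) \<Longrightarrow> x \<in> space M \<Longrightarrow> 0 \<le> L f x"
  by (simp add: L_def markov_op_nonneg)

lemma L_cong: "(\<And>y. y \<in> space M \<Longrightarrow> f y = g y) \<Longrightarrow> x \<in> space M \<Longrightarrow> L f x = L g x"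
  using markov_op_cong[of f g] by (simp add: L_def)

lemma L_add_const:
  assumes "x \<in> space M" "f \<in> bounded_measurable M"
  shows "L (\<lambda>y. f y + c) x = L f x + c"
  using assms by (simp add: L_def markov_op_add bounded_measurable_const markov_op_const field_simps)

lemma L_symmetric:
  assumes "f \<in> bounded_measurable M" "g \<in> bounded_measurable M"
  shows "ip f (L g) = ip g (L f)"
  unfolding L_eq by (simp add: ip_simps bm_intros assms markov_op_symmetric[OF assms] ip_commute[of f g])

text \<open>Self-adjointness: the pairings depend on \<open>i + k\<close> only, so a single sequence
  of moments describes all of them.\<close>

lemma ip_L_pow:
  assumes "f \<in> bounded_measurable M"
  shows "ip ((L ^^ i) f) ((L ^^ k) f) = ip ((L ^^ (i + k)) f) f"
proof (induction k arbitrary: i)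
  case (Suc k)
  have "ip ((L ^^ i) f) ((L ^^ Suc k) f) = ip ((L ^^ Suc i) f) ((L ^^ k) f)"
    by (simp add: L_symmetric bm_intros assms ip_commute)
  then show ?case using Suc[of "Suc i"] by simp
qed simp

text \<open>Exactly, \<open>4 * ip f (L f)\<close> is the squared norm of \<open>f + K f\<close>
  plus the defect \<open>ip f f - ip (K f) (K f)\<close>, which is nonnegative by contraction. The
  same defect yields the next two lemmas; together they say that 0 \<le> L, L^2 \<le> L and L \<le>
  1 as quadratic forms.\<close>

lemma ip_L_nonneg:
  assumes "f \<in> bounded_measurable M"
  shows "0 \<le> ip f (L f)"
proof -
  have "0 \<le> ip (\<lambda>x. f x + K f x) (\<lambda>x. f x + K f x)" by (rule ip_self_nonneg)
  also have "\<dots> = ip f f + 2 * ip f (K f) + ip (K f) (K f)"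
    by (simp add: ip_simps bm_intros assms ip_commute[of "K f" f])
  finally show ?thesis
    using markov_op_contraction[OF assms] by (simp add: L_eq ip_simps bm_intros assms)
qed

lemma ip_L_le:
  assumes "f \<in> bounded_measurable M"
  shows "ip f (L f) \<le> ip f f"
proof -
  have "0 \<le> ip (\<lambda>x. f x - K f x) (\<lambda>x. f x - K f x)" by (rule ip_self_nonneg)
  also have "\<dots> = ip f f - 2 * ip f (K f) + ip (K f) (K f)"
    by (simp add: ip_simps bm_intros assms ip_commute[of "K f" f])
  finally show ?thesis
    using markov_op_contraction[OF assms] by (simp add: L_eq ip_simps bm_intros assms)
qed

lemma ip_L_L_le:
  assumes "f \<in> bounded_measurable M"
  shows "ip (L f) (L f) \<le> ip f (L f)"
  using markov_op_contraction[OF assms]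
  by (simp add: L_eq ip_simps bm_intros assms ip_commute[of "K f" f])

text \<open>With \<open>a\<close> the moments of \<open>f\<close>, the second difference at index
  \<open>2 * k\<close> is the squared norm of \<open>d k\<close>, and the one at
  \<open>2 * k + 1\<close> is \<open>ip (d k) (L (d k))\<close>, nonnegative and dropped. In
  \<open>second_difference_sum\<close> the index \<open>2 * k\<close> carries the weight
  \<open>2 * k + 1\<close>.\<close>

lemma sum_increments_le:
  assumes f: "f \<in> bounded_measurable M"
  defines "d \<equiv> \<lambda>k x. (L ^^ k) f x - (L ^^ Suc k) f x"
  shows "(\<Sum>k<n. real (2 * k + 1) * ip (d k) (d k)) \<le> ip f f"
proof -
  define a where "a j = ip ((L ^^ j) f) f" for j
  define D where "D j = a j - 2 * a (Suc j) + a (Suc (Suc j))" for j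
  note bm = bm_intros f
  have ip_a: "ip ((L ^^ i) f) ((L ^^ k) f) = a (i + k)" for i k
    unfolding a_def by (rule ip_L_pow[OF f])
  have a_even: "a (2 * k) = ip ((L ^^ k) f) ((L ^^ k) f)"
    and a_odd: "a (Suc (2 * k)) = ip ((L ^^ k) f) (L ((L ^^ k) f))"
    and a_even': "a (Suc (Suc (2 * k))) = ip (L ((L ^^ k) f)) (L ((L ^^ k) f))" for k
    using ip_a[of k k] ip_a[of k "Suc k"] ip_a[of "Suc k" "Suc k"] by (simp_all add: mult_2)
  \<comment> \<open>Even moments are squared norms of \<open>L^k f\<close>, odd ones are values of
    the form of \<open>L\<close> at \<open>L^k f\<close>, so the three form bounds cover both
    parities.\<close>
  have a_nonneg: "0 \<le> a j" and a_dec: "a (Suc j) \<le> a j" for j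
  proof -
    consider k where "j = 2 * k" | k where "j = Suc (2 * k)"
      by (metis oddE evenE Suc_eq_plus1)
    then show "0 \<le> a j" "a (Suc j) \<le> a j"
      by (cases; simp add: a_even a_odd a_even' ip_self_nonneg ip_L_nonneg ip_L_le ip_L_L_le bm)+
  qed
  have D_even: "D (2 * k) = ip (d k) (d k)" for k
    by (simp add: D_def a_even a_odd a_even' d_def ip_simps bm ip_commute[of "L ((L ^^ k) f)" "(L ^^ k) f"])
  have D_odd: "0 \<le> D (Suc (2 * k))" for k
  proof -
    have "a (Suc (Suc (Suc (2 * k)))) = ip (L ((L ^^ k) f)) (L (L ((L ^^ k) f)))"
      using ip_a[of "Suc k" "Suc (Suc k)"] by (simp add: mult_2)
    moreover have "a (Suc (Suc (2 * k))) = ip ((L ^^ k) f) (L (L ((L ^^ k) f)))"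
      using ip_a[of k "Suc (Suc k)"] by (simp add: mult_2)
    ultimately have "D (Suc (2 * k)) = ip (d k) (L (d k))"
      unfolding D_def d_def a_odd
      by (simp add: L_diff ip_simps bm a_even'[symmetric])
    then show ?thesis by (simp add: ip_L_nonneg d_def bm del: funpow.simps)
  qed
  have "(\<Sum>k<n. real (2 * k + 1) * ip (d k) (d k)) \<le> (\<Sum>j<2 * n. real (Suc j) * D j)"
  proof (induction n)
    case (Suc n)
    have "(\<Sum>j<2 * Suc n. real (Suc j) * D j) =
      (\<Sum>j<2 * n. real (Suc j) * D j) + real (2 * n + 1) * ip (d n) (d n) + real (2 * n + 2) * D (Suc (2 * n))"
      by (simp add: D_even[symmetric] algebra_simps)
    moreover have "0 \<le> real (2 * n + 2) * D (Suc (2 * n))" by (intro mult_nonneg_nonneg D_odd) simp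
    ultimately show ?case using Suc by simp
  qed simp
  also have "\<dots> \<le> a 0" unfolding D_def by (intro second_difference_sum a_nonneg a_dec)
  finally show ?thesis by (simp add: a_def)
qed

section \<open>Spectral gap from hitting times\<close>

text \<open>The expected hitting time of \<open>A\<close> satisfies this with \<open>H\<close> any upper bound for it.\<close>

definition hitting_bound :: "'a set \<Rightarrow> real \<Rightarrow> ('a \<Rightarrow> real) \<Rightarrow> bool" where
  "hitting_bound A H h \<longleftrightarrow> h \<in> bounded_measurable M \<and> (\<forall>x\<in>space M \<inter> A. h x = 0) \<and>
    (\<forall>x\<in>space M - A. 1 \<le> h x \<and> h x \<le> H \<and> K h x \<le> h x - 1)"

text \<open>Ground-state substitution. The product \<open>f x * f y\<close> is bounded by the
  symmetrization of \<open>q x * h y\<close>; integrating and using symmetry leaves only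
  \<open>ip q (K h)\<close>, where the supersolution property gives
  \<open>q * (h - 1) = f^2 - f^2 / h\<close>, and \<open>h \<le> H\<close> produces the gap.\<close>

lemma dirichlet_gap:
  assumes h: "hitting_bound A H h" and H: "1 \<le> H"
    and f: "f \<in> bounded_measurable M" and f0: "\<And>x. x \<in> space M \<inter> A \<Longrightarrow> f x = 0"
  shows "ip f (K f) \<le> (1 - 1 / H) * ip f f"
proof -
  \<comment> \<open>On \<open>A\<close> division by zero gives 0, in accordance with
    \<open>f = 0\<close> there; off \<open>A\<close> the bound \<open>1 \<le> h\<close> keeps
    \<open>q\<close> bounded.\<close>
  define q where "q x = (f x)\<^sup>2 / h x" for x
  have hb [bm_intros]: "h \<in> bounded_measurable M"
    and hA: "\<And>x. x \<in> space M \<Longrightarrow> x \<in> A \<Longrightarrow> h x = 0"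
    and hB: "\<And>x. x \<in> space M \<Longrightarrow> x \<notin> A \<Longrightarrow> 1 \<le> h x \<and> h x \<le> H \<and> K h x \<le> h x - 1"
    using h unfolding hitting_bound_def by auto
  have h0: "0 \<le> h x" if "x \<in> space M" for x using hA hB that by fastforce
  have qA: "q x = 0" if "x \<in> space M" "x \<in> A" for x using that by (simp add: q_def f0)
  have q0: "0 \<le> q x" if "x \<in> space M" for x using h0[OF that] by (simp add: q_def)
  have qb [bm_intros]: "q \<in> bounded_measurable M"
  proof -
    obtain C where C: "0 \<le> C" "\<And>x. x \<in> space M \<Longrightarrow> \<bar>f x\<bar> \<le> C"
      using f by (metis bounded_measurableE)
    have "\<bar>q x\<bar> \<le> C\<^sup>2" if x: "x \<in> space M" for x
    proof (cases "x \<in> A")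
      case False
      then have "1 \<le> h x" using hB x by blast
      then have "q x \<le> (f x)\<^sup>2" by (simp add: q_def divide_le_eq mult_le_cancel_left1)
      also have "\<dots> \<le> C\<^sup>2" using C(1) C(2)[OF x] by (simp add: abs_le_square_iff[symmetric])
      finally show ?thesis using q0[OF x] by simp
    qed (simp add: qA x)
    moreover have "q \<in> borel_measurable M" unfolding q_def using f hb by measurable
    ultimately show ?thesis by (intro bounded_measurableI) auto
  qed
  \<comment> \<open>The arithmetic-geometric mean inequality: the product of the two summands is the
    square of \<open>f x * f y\<close>.\<close>
  have point: "f x * f y \<le> (q x * h y + h x * q y) / 2" if x: "x \<in> space M" and y: "y \<in> space M" for x y
  proof (cases "x \<in> A \<or> y \<in> A")
    case True
    then show ?thesis using f0 x y q0 h0 by (auto simp: mult_nonneg_nonneg)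
  next
    case False
    then have "1 \<le> h x" "1 \<le> h y" using hB x y by auto
    then have pos: "0 < h x" "0 < h y" by auto
    have "(q x * h y + h x * q y) / 2 - f x * f y = (f x * h y - f y * h x)\<^sup>2 / (2 * h x * h y)"
      using pos by (simp add: q_def field_simps power2_eq_square)
    also have "\<dots> \<ge> 0" using pos by simp
    finally show ?thesis by simp
  qed
  have "f x * K f x \<le> (q x * K h x + h x * K q x) / 2" if x: "x \<in> space M" for x
  proof -
    have "f x * K f x = K (\<lambda>y. f x * f y) x" by (simp add: markov_op_cmult)
    also have "\<dots> \<le> K (\<lambda>y. (q x * h y + h x * q y) / 2) x"
      by (intro markov_op_mono x bm_intros f point)
    finally show ?thesis by (simp add: markov_op_divide markov_op_add markov_op_cmult bm_intros)
  qed
  then have "ip f (K f) \<le> (\<integral>x. (q x * K h x + h x * K q x) / 2 \<partial>M)"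
    unfolding ip_def by (intro integral_mono bounded_measurable_integrable bm_intros f)
  also have "\<dots> = (ip q (K h) + ip h (K q)) / 2"
    by (simp add: ip_def ip_integrable bm_intros)
  also have "\<dots> = ip q (K h)" by (simp add: markov_op_symmetric[of h q] bm_intros)
  also have "\<dots> \<le> (\<integral>x. (1 - 1 / H) * (f x * f x) \<partial>M)"
    unfolding ip_def
  proof (intro integral_mono bounded_measurable_integrable bm_intros f)
    fix x assume x: "x \<in> space M"
    show "q x * K h x \<le> (1 - 1 / H) * (f x * f x)"
    proof (cases "x \<in> A")
      case False
      then have hx: "1 \<le> h x" "h x \<le> H" "K h x \<le> h x - 1" using hB x by auto
      have "q x * K h x \<le> q x * (h x - 1)" by (intro mult_left_mono hx q0 x)
      also have "\<dots> = (f x)\<^sup>2 - (f x)\<^sup>2 / h x" using hx by (simp add: q_def field_simps)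
      also have "\<dots> \<le> (f x)\<^sup>2 - (f x)\<^sup>2 / H" using hx by (intro diff_left_mono divide_left_mono) auto
      finally show ?thesis using H by (simp add: power2_eq_square field_simps)
    qed (simp add: f0 x qA)
  qed
  finally show ?thesis by (simp add: ip_def)
qed

text \<open>The positive and negative parts of \<open>f - m\<close> both vanish on a set of measure
  at least 1/2, so \<open>dirichlet_gap\<close> applies to each. The cross term
  \<open>- 2 * ip u (K v)\<close> has the favourable sign because \<open>u\<close> and
  \<open>v\<close> are nonnegative.\<close>

lemma spectral_gap:
  assumes hit: "\<And>A. A \<in> sets M \<Longrightarrow> 1 / 2 \<le> prob A \<Longrightarrow> \<exists>h. hitting_bound A H h" and H: "1 \<le> H"
    and f: "f \<in> bounded_measurable M" and mean: "(\<integral>x. f x \<partial>M) = 0"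
  shows "ip f (K f) \<le> (1 - 1 / H) * ip f f"
proof -
  have [measurable]: "f \<in> borel_measurable M" using f by auto
  obtain m where m: "1 / 2 \<le> prob {x \<in> space M. f x \<le> m}" "1 / 2 \<le> prob {x \<in> space M. m \<le> f x}"
    by (rule median_exists[of f]) auto
  define g u v where "g x = f x - m" and "u x = max 0 (f x - m)" and "v x = max 0 (m - f x)" for x
  have bm [bm_intros]: "g \<in> bounded_measurable M" "u \<in> bounded_measurable M" "v \<in> bounded_measurable M"
    unfolding g_def[abs_def] u_def[abs_def] v_def[abs_def] by (intro bm_intros f)+
  have guv: "g = (\<lambda>x. u x - v x)" by (auto simp: g_def u_def v_def fun_eq_iff)
  obtain hu where "hitting_bound {x \<in> space M. f x \<le> m} H hu" using hit[OF _ m(1)] by auto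
  then have u: "ip u (K u) \<le> (1 - 1 / H) * ip u u"
    by (rule dirichlet_gap) (auto simp: H bm u_def)
  obtain hv where "hitting_bound {x \<in> space M. m \<le> f x} H hv" using hit[OF _ m(2)] by auto
  then have v: "ip v (K v) \<le> (1 - 1 / H) * ip v v"
    by (rule dirichlet_gap) (auto simp: H bm v_def)
  have uv: "ip u v = 0" unfolding ip_def u_def v_def by (intro integral_eq_zero_AE AE_I2) auto
  have uKv: "0 \<le> ip u (K v)"
    unfolding ip_def by (intro integral_nonneg_AE AE_I2 mult_nonneg_nonneg markov_op_nonneg) (auto simp: u_def v_def)
  have "ip g (K g) = ip u (K u) + ip v (K v) - 2 * ip u (K v)"
    by (simp add: guv markov_op_diff ip_simps bm_intros markov_op_symmetric[of v u])
  moreover have "ip g g = ip u u + ip v v"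
    by (simp add: guv ip_simps bm_intros uv ip_commute[of v u])
  ultimately have gap_g: "ip g (K g) \<le> (1 - 1 / H) * ip g g" using u v uKv by (simp add: algebra_simps)
  \<comment> \<open>Undoing the shift: as \<open>f\<close> has mean zero, subtracting
    \<open>m\<close> adds \<open>m^2\<close> to both forms, and
    \<open>(1 - 1 / H) * m^2 \<le> m^2\<close>.\<close>
  have int: "integrable M f" "integrable M (K f)" "integrable M (\<lambda>x. f x * K f x)" "integrable M (\<lambda>x. f x * f x)"
    by (intro bounded_measurable_integrable bm_intros f)+
  have "ip g (K g) = (\<integral>x. f x * K f x - m * f x - m * K f x + m * m \<partial>M)"
    unfolding ip_def
  proof (intro Bochner_Integration.integral_cong refl)
    fix x assume "x \<in> space M"
    then have Kg: "K g x = K f x - m" unfolding g_def by (simp add: markov_op_diff f bm_intros markov_op_const)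
    have "g x * K g x = (f x - m) * (K f x - m)" unfolding Kg by (simp only: g_def[of x])
    then show "g x * K g x = f x * K f x - m * f x - m * K f x + m * m" by (simp add: algebra_simps)
  qed
  also have "\<dots> = ip f (K f) + m * m"
    by (simp add: int mean integral_markov_op f ip_def prob_space)
  finally have *: "ip g (K g) = ip f (K f) + m * m" .
  have "ip g g = (\<integral>x. f x * f x - 2 * m * f x + m * m \<partial>M)"
    unfolding ip_def g_def by (simp add: algebra_simps)
  also have "\<dots> = ip f f + m * m" by (simp add: int mean ip_def prob_space)
  finally have "ip f (K f) + m * m \<le> (1 - 1 / H) * (ip f f + m * m)" using gap_g * by simp
  moreover have "(1 - 1 / H) * (m * m) \<le> m * m" using H by (intro mult_left_le_one_le) auto
  ultimately show ?thesis by (simp add: ring_distribs)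
qed

text \<open>The gap controls \<open>K\<close> only near 1, while its spectrum may come close to -1.
  The term \<open>ip (K F) (K F)\<close> is therefore bounded by \<open>ip F F\<close> alone, and
  the gap \<open>1 / H\<close> of \<open>K\<close> becomes \<open>1 / (2 * H)\<close> for the
  squared norm of \<open>L F\<close>. Mean zero is preserved by \<open>L\<close>, so the gap is
  available at every power.\<close>

lemma L_contraction:
  assumes hit: "\<And>A. A \<in> sets M \<Longrightarrow> 1 / 2 \<le> prob A \<Longrightarrow> \<exists>h. hitting_bound A H h" and H: "1 \<le> H"
    and f: "f \<in> bounded_measurable M" and mean: "(\<integral>x. f x \<partial>M) = 0"
  shows "ip ((L ^^ n) f) ((L ^^ n) f) \<le> (1 - 1 / (2 * H)) ^ n * ip f f"
proof (induction n)
  case (Suc n)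
  define F where "F = (L ^^ n) f"
  have F [bm_intros]: "F \<in> bounded_measurable M" unfolding F_def by (intro bm_intros f)
  have "(\<integral>x. (L ^^ n) f x \<partial>M) = 0"
  proof (induction n)
    case (Suc n)
    have "(\<integral>x. L ((L ^^ n) f) x \<partial>M) = (\<integral>x. (L ^^ n) f x \<partial>M)"
      unfolding L_def[of "(L ^^ n) f"]
      by (simp add: integral_markov_op bm_intros f bounded_measurable_integrable)
    then show ?case using Suc by simp
  qed (simp add: mean)
  then have gap: "ip F (K F) \<le> (1 - 1 / H) * ip F F"
    unfolding F_def by (intro spectral_gap hit H bm_intros f) auto
  have "ip (L F) (L F) = (ip F F + 2 * ip F (K F) + ip (K F) (K F)) / 4"
    by (simp add: L_eq ip_simps bm_intros ip_commute[of "K F" F])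
  also have "\<dots> \<le> (1 - 1 / (2 * H)) * ip F F"
  proof -
    have "ip F (K F) \<le> ip F F - ip F F / H" using gap by (simp add: algebra_simps)
    then have "(ip F F + 2 * ip F (K F) + ip (K F) (K F)) / 4 \<le> ip F F - ip F F / H / 2"
      using markov_op_contraction[OF F] by simp
    then show ?thesis by (simp add: algebra_simps)
  qed
  also have "\<dots> \<le> (1 - 1 / (2 * H)) * ((1 - 1 / (2 * H)) ^ n * ip f f)"
    using Suc H by (intro mult_left_mono) (auto simp: F_def)
  finally show ?case by (simp add: F_def)
qed simp

lemma chebyshev_square:
  assumes "f \<in> bounded_measurable M" "0 < c"
  shows "prob {x \<in> space M. c < \<bar>f x\<bar>} \<le> ip f f / c\<^sup>2"
proof -
  have [measurable]: "f \<in> borel_measurable M" using assms by auto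
  have "c\<^sup>2 * prob {x \<in> space M. c < \<bar>f x\<bar>} = (\<integral>x. c\<^sup>2 * indicator {x \<in> space M. c < \<bar>f x\<bar>} x \<partial>M)"
    by simp
  also have "\<dots> \<le> ip f f"
    unfolding ip_def
  proof (intro integral_mono bounded_measurable_integrable bm_intros assms)
    fix x show "c\<^sup>2 * indicator {x \<in> space M. c < \<bar>f x\<bar>} x \<le> f x * f x"
      using \<open>0 < c\<close> abs_le_square_iff[of c "f x"] by (auto simp: indicator_def power2_eq_square)
  qed simp
  finally show ?thesis using \<open>0 < c\<close> by (simp add: field_simps)
qed

section \<open>Mixing of the lazy operator\<close>

text \<open>\<open>killed A n x\<close> is the probability that the lazy chain started at \<open>x\<close> avoids \<open>A\<close> up to time \<open>n\<close>.\<close>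

primrec killed :: "'a set \<Rightarrow> nat \<Rightarrow> 'a \<Rightarrow> real" where
  "killed A 0 = (\<lambda>x. indicator (space M - A) x)"
| "killed A (Suc n) = (\<lambda>x. indicator (space M - A) x * L (killed A n) x)"

lemma bounded_measurable_killed [bm_intros]:
  "A \<in> sets M \<Longrightarrow> killed A n \<in> bounded_measurable M"
  by (induction n) (auto intro!: bm_intros)

lemma killed_nonneg: "x \<in> space M \<Longrightarrow> 0 \<le> killed A n x"
  by (induction n arbitrary: x) (auto simp: L_nonneg)

lemma killed_decreasing:
  assumes "A \<in> sets M" "x \<in> space M"
  shows "killed A (Suc n) x \<le> killed A n x"
  using assms(2)
proof (induction n arbitrary: x)
  case 0
  have "L (killed A 0) x \<le> L (\<lambda>_. 1) x"
    by (intro L_mono 0 bm_intros assms) (auto simp: indicator_def)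
  then show ?case using 0 by (auto simp: L_const indicator_def)
next
  case (Suc n)
  have "L (killed A (Suc n)) x \<le> L (killed A n) x"
    by (intro L_mono Suc bm_intros assms)
  then show ?case by (auto simp: indicator_def)
qed

text \<open>Off \<open>A\<close> one has \<open>L h \<le> h - 1 / 2\<close>, so \<open>2 * h\<close>
  is a supersolution for the lazy chain, which stays put half of the time. Hence the survival
  probabilities sum to at most \<open>2 * h\<close>, and as they decrease in time the first
  \<open>n\<close> of them are at least the \<open>n\<close>-th.\<close>

lemma killed_le:
  assumes h: "hitting_bound A H h" and A: "A \<in> sets M" and x: "x \<in> space M" and H: "0 \<le> H"
  shows "real n * killed A n x \<le> 2 * H"
proof -
  have hb [bm_intros]: "h \<in> bounded_measurable M"
    and hA: "\<And>x. x \<in> space M \<Longrightarrow> x \<in> A \<Longrightarrow> h x = 0"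
    and hB: "\<And>x. x \<in> space M \<Longrightarrow> x \<notin> A \<Longrightarrow> 1 \<le> h x \<and> h x \<le> H \<and> K h x \<le> h x - 1"
    using h unfolding hitting_bound_def by auto
  have sum: "(\<Sum>j<m. killed A j y) / 2 \<le> h y" if "y \<in> space M" for m y
    using that
  proof (induction m arbitrary: y)
    case 0
    then show ?case using hA[of y] hB[of y] by (cases "y \<in> A") auto
  next
    case (Suc m)
    have Lsum: "L (\<lambda>z. \<Sum>j<m. killed A j z) y = (\<Sum>j<m. L (killed A j) y)"
    proof (induction m)
      case (Suc m)
      have "L (\<lambda>z. (\<Sum>j<m. killed A j z) + killed A m z) y = L (\<lambda>z. \<Sum>j<m. killed A j z) y + L (killed A m) y"
        unfolding L_def by (subst markov_op_add) (auto simp: add_divide_distrib intro!: bm_intros A)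
      then show ?case using Suc by simp
    qed (simp add: L_const Suc.prems)
    show ?case
    proof (cases "y \<in> A")
      case True
      then have "killed A j y = 0" for j by (cases j) auto
      then show ?thesis using hA[of y] True Suc.prems by simp
    next
      case False
      have "(\<Sum>j<Suc m. killed A j y) = killed A 0 y + (\<Sum>j<m. killed A (Suc j) y)"
        by (rule sum.lessThan_Suc_shift)
      also have "\<dots> = 1 + L (\<lambda>z. \<Sum>j<m. killed A j z) y"
        using False Suc.prems by (simp add: Lsum)
      finally have "(\<Sum>j<Suc m. killed A j y) = 1 + L (\<lambda>z. \<Sum>j<m. killed A j z) y" .
      moreover have "L (\<lambda>z. \<Sum>j<m. killed A j z) y \<le> L (\<lambda>z. h z + h z) y"
      proof (intro L_mono Suc.prems bm_intros A)
        fix z assume "z \<in> space M"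
        then show "(\<Sum>j<m. killed A j z) \<le> h z + h z" using Suc.IH[of z] by simp
      qed
      moreover have "L (\<lambda>z. h z + h z) y = h y + K h y"
        unfolding L_def[of "\<lambda>z. h z + h z"] markov_op_add[OF hb hb] by simp
      ultimately show ?thesis using hB[OF Suc.prems False] by linarith
    qed
  qed
  have "real n * killed A n x = (\<Sum>j<n. killed A n x)" by simp
  also have "\<dots> \<le> (\<Sum>j<n. killed A j x)"
  proof (rule sum_mono)
    fix j assume "j \<in> {..<n}"
    then show "killed A n x \<le> killed A j x"
      by (intro lift_Suc_antimono_le[of "\<lambda>j. killed A j x", OF killed_decreasing[OF A x]]) simp
  qed
  also have "\<dots> \<le> 2 * h x" using sum[OF x, of n] by simp
  also have "\<dots> \<le> 2 * H" using hA[OF x] hB[OF x] H by (cases "x \<in> A") auto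
  finally show ?thesis .
qed

text \<open>Wait until the chain hits the set where all the later values of \<open>L\<^sup>k f\<close> are small.\<close>

lemma L_pow_le_killed:
  assumes A: "A \<in> sets M" and f: "f \<in> bounded_measurable M"
    and f1: "\<And>x. x \<in> space M \<Longrightarrow> \<bar>f x\<bar> \<le> 1" and \<delta>: "0 \<le> \<delta>"
    and small: "\<And>x j. x \<in> space M \<inter> A \<Longrightarrow> j \<le> n \<Longrightarrow> \<bar>(L ^^ j) f x\<bar> \<le> \<delta>"
    and x: "x \<in> space M"
  shows "\<bar>(L ^^ n) f x\<bar> \<le> killed A n x + \<delta>"
  using small x
proof (induction n arbitrary: x)
  case 0
  then show ?case using f1[of x] \<delta> by (cases "x \<in> A") fastforce+
next
  case (Suc n)
  show ?case
  proof (cases "x \<in> A")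
    case True
    then have "\<bar>(L ^^ Suc n) f x\<bar> \<le> \<delta>" using Suc.prems by blast
    then show ?thesis using killed_nonneg[OF Suc.prems(2), of A "Suc n"] by linarith
  next
    case False
    have "\<bar>L ((L ^^ n) f) x\<bar> \<le> L (\<lambda>y. \<bar>(L ^^ n) f y\<bar>) x"
      by (intro L_abs Suc.prems bm_intros f)
    also have "\<dots> \<le> L (\<lambda>y. killed A n y + \<delta>) x"
      using Suc.prems(1) by (intro L_mono Suc bm_intros f A) auto
    also have "\<dots> = killed A (Suc n) x + \<delta>"
      using False Suc.prems by (simp add: L_add_const bm_intros A)
    finally show ?thesis by simp
  qed
qed

text \<open>The 55 collects \<open>20 * H\<close> for L2 decay, \<open>16 * H\<close> twice for the
  start and the length of the window, and at most 3 for rounding up, which \<open>1 \<le> H\<close>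
  absorbs.\<close>

theorem lazy_mixing:
  assumes hit: "\<And>A. A \<in> sets M \<Longrightarrow> 1 / 2 \<le> prob A \<Longrightarrow> \<exists>h. hitting_bound A H h" and H: "1 \<le> H"
  obtains n :: nat where "real n \<le> 55 * H"
    "\<And>A x. A \<in> sets M \<Longrightarrow> x \<in> space M \<Longrightarrow> \<bar>(L ^^ n) (indicator A) x - prob A\<bar> \<le> 1 / 4"
proof -
  \<comment> \<open>After \<open>r\<close> steps the squared norm is at most exp (-10) \<le> 1/1024;
    after \<open>T\<close> steps survival has probability at most
    \<open>2 * H / T \<le> 1 / 8\<close>.\<close>
  define r where "r = nat \<lceil>20 * H\<rceil>"
  define T where "T = nat \<lceil>16 * H\<rceil>"
  have r: "20 * H \<le> real r" "real r \<le> 20 * H + 1" and T: "16 * H \<le> real T" "real T \<le> 16 * H + 1"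
    unfolding r_def T_def using H by linarith+
  have T_pos: "0 < real T" using T H by linarith
  have decay: "(1 - 1 / (2 * H)) ^ r \<le> 1 / 1024"
  proof -
    have "(1 - 1 / (2 * H)) ^ r \<le> exp (- 1 / (2 * H)) ^ r"
      using exp_ge_add_one_self[of "- 1 / (2 * H)"] H by (intro power_mono) auto
    also have "\<dots> = exp (- (real r / (2 * H)))" by (simp add: exp_of_nat_mult[symmetric])
    also have "\<dots> \<le> exp (- 10)" using r H by (simp add: field_simps)
    also have "\<dots> = inverse (exp 1 ^ 10)" by (simp add: exp_minus exp_of_nat_mult[symmetric])
    also have "\<dots> \<le> inverse (2 ^ 10)"
      using exp_ge_add_one_self[of 1] by (intro le_imp_inverse_le power_mono) auto
    finally show ?thesis by simp
  qed
  show thesis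
  proof (rule that[of "T + T + r"])
    show "real (T + T + r) \<le> 55 * H" using r T H by simp
    fix A x assume A: "A \<in> sets M" and x: "x \<in> space M"
    define f0 where "f0 y = indicator A y - prob A" for y
    define f where "f = (L ^^ r) f0"
    have f0 [bm_intros]: "f0 \<in> bounded_measurable M" unfolding f0_def[abs_def] by (intro bm_intros A)
    have f [bm_intros]: "f \<in> bounded_measurable M" unfolding f_def by (intro bm_intros)
    have f0_1: "\<bar>f0 y\<bar> \<le> 1" for y using prob_le_1[of A] by (auto simp: f0_def indicator_def)
    have le1: "\<bar>(L ^^ n) f0 y\<bar> \<le> 1" if "y \<in> space M" for y n
      using that
    proof (induction n arbitrary: y)
      case (Suc n)
      have "L (\<lambda>y. \<bar>(L ^^ n) f0 y\<bar>) y \<le> L (\<lambda>_. 1) y" by (intro L_mono Suc bm_intros)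
      then show ?case using L_abs[OF Suc.prems, of "(L ^^ n) f0"] by (simp add: L_const Suc.prems bm_intros)
    qed (simp add: f0_1)
    have "(\<integral>y. f0 y \<partial>M) = 0" using A unfolding f0_def
      by (subst Bochner_Integration.integral_diff) (auto simp: prob_space bounded_measurable_integrable bm_intros)
    then have "ip f f \<le> (1 - 1 / (2 * H)) ^ r * ip f0 f0"
      unfolding f_def by (intro L_contraction hit H f0) auto
    also have "\<dots> \<le> 1 / 1024 * 1"
    proof (intro mult_mono decay ip_self_nonneg)
      have "f0 y * f0 y \<le> 1" for y using f0_1[of y] by (metis abs_square_le_1 power2_eq_square)
      then have "ip f0 f0 \<le> (\<integral>y. 1 \<partial>M)"
        unfolding ip_def by (intro integral_mono bounded_measurable_integrable bm_intros)
      then show "ip f0 f0 \<le> 1" by (simp add: prob_space)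
    qed (use H in auto)
    finally have ipf: "ip f f \<le> 1 / 1024" by simp
    define d where "d k y = (L ^^ k) f y - (L ^^ Suc k) f y" for k y
    have d [bm_intros]: "d k \<in> bounded_measurable M" for k unfolding d_def[abs_def] by (intro bm_intros)
    \<comment> \<open>\<open>u y\<close> bounds the total movement of \<open>L^k f y\<close> for
      \<open>k\<close> from \<open>T\<close> to \<open>2 * T\<close>, so one inequality for
      \<open>u\<close> handles all times of the window.\<close>
    define u where "u y = (\<Sum>k=T..<T+T. \<bar>d k y\<bar>)" for y
    have u [bm_intros]: "u \<in> bounded_measurable M" unfolding u_def[abs_def] by (intro bm_intros)
    have sum_d: "(\<Sum>k=T..<T+T. real T * ip (d k) (d k)) \<le> ip f f"
    proof -
      have "(\<Sum>k=T..<T+T. real T * ip (d k) (d k)) \<le> (\<Sum>k=T..<T+T. real (2 * k + 1) * ip (d k) (d k))"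
        by (intro sum_mono mult_right_mono ip_self_nonneg) auto
      also have "\<dots> \<le> (\<Sum>k<T+T. real (2 * k + 1) * ip (d k) (d k))"
        by (intro sum_mono2 mult_nonneg_nonneg ip_self_nonneg) auto
      also have "\<dots> \<le> ip f f" unfolding d_def[abs_def] by (intro sum_increments_le f)
      finally show ?thesis .
    qed
    \<comment> \<open>Cauchy-Schwarz over the \<open>T\<close> summands costs a factor
      \<open>T\<close>, which the weights pay for: \<open>2 * k + 1 \<ge> T\<close> throughout the
      window.\<close>
    have "ip u u \<le> (\<integral>y. (\<Sum>k=T..<T+T. real T * (d k y * d k y)) \<partial>M)"
      unfolding ip_def
    proof (intro integral_mono bounded_measurable_integrable bm_intros)
      fix y
      have "(u y)\<^sup>2 \<le> (\<Sum>k=T..<T+T. \<bar>d k y\<bar>\<^sup>2) * (\<Sum>k=T..<T+T. 1\<^sup>2)"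
        unfolding u_def using Cauchy_Schwarz_ineq_sum[of "\<lambda>k. \<bar>d k y\<bar>" "\<lambda>_. 1" "{T..<T+T}"] by simp
      then show "u y * u y \<le> (\<Sum>k=T..<T+T. real T * (d k y * d k y))"
        by (simp add: power2_eq_square sum_distrib_left[symmetric] mult.commute)
    qed
    also have "\<dots> = (\<Sum>k=T..<T+T. real T * ip (d k) (d k))"
      unfolding ip_def by (subst Bochner_Integration.integral_sum) (auto intro!: bounded_measurable_integrable bm_intros)
    finally have ipu: "ip u u \<le> 1 / 1024" using sum_d ipf by linarith
    have ipFT: "ip ((L ^^ T) f) ((L ^^ T) f) \<le> 1 / 1024"
    proof -
      have "ip ((L ^^ n) f) ((L ^^ n) f) \<le> ip f f" for n
      proof (induction n)
        case (Suc n)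
        then show ?case
          using ip_L_L_le[of "(L ^^ n) f"] ip_L_le[of "(L ^^ n) f"] by (simp add: bm_intros)
      qed simp
      from order_trans[OF this ipf] show ?thesis .
    qed
    \<comment> \<open>By Chebyshev each of the two sets has measure at most (1/1024) / (1/16)^2 =
      1/4.\<close>
    define B where "B = {y \<in> space M. 1 / 16 < \<bar>(L ^^ T) f y\<bar>} \<union> {y \<in> space M. 1 / 16 < \<bar>u y\<bar>}"
    have [measurable]: "(L ^^ T) f \<in> borel_measurable M" "u \<in> borel_measurable M"
      using u bounded_measurable_L_pow[OF f] by auto
    have B [measurable]: "B \<in> sets M" unfolding B_def by measurable
    have "prob B \<le> prob {y \<in> space M. 1 / 16 < \<bar>(L ^^ T) f y\<bar>} + prob {y \<in> space M. 1 / 16 < \<bar>u y\<bar>}"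
      unfolding B_def by (intro measure_Un_le) measurable
    also have "\<dots> \<le> 1 / 4 + 1 / 4"
    proof (rule add_mono)
      show "prob {y \<in> space M. 1 / 16 < \<bar>(L ^^ T) f y\<bar>} \<le> 1 / 4"
        by (rule order_trans[OF chebyshev_square]) (use ipFT in \<open>simp_all add: bm_intros power2_eq_square\<close>)
      show "prob {y \<in> space M. 1 / 16 < \<bar>u y\<bar>} \<le> 1 / 4"
        by (rule order_trans[OF chebyshev_square]) (use ipu in \<open>simp_all add: bm_intros power2_eq_square\<close>)
    qed
    finally have "prob B \<le> 1 / 2" by simp
    define G where "G = space M - B"
    have G: "G \<in> sets M" "1 / 2 \<le> prob G"
      using \<open>prob B \<le> 1 / 2\<close> by (auto simp: G_def prob_compl)
    then obtain h where h: "hitting_bound G H h" using hit by blast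
    \<comment> \<open>At most 1/16 at the start of the window plus at most 1/16 of movement inside
      it.\<close>
    have small: "\<bar>(L ^^ j) ((L ^^ T) f) y\<bar> \<le> 1 / 8" if y: "y \<in> space M \<inter> G" and j: "j \<le> T" for y j
    proof -
      have y': "\<bar>(L ^^ T) f y\<bar> \<le> 1 / 16" "\<bar>u y\<bar> \<le> 1 / 16" using y by (auto simp: G_def B_def)
      have "(L ^^ T) f y - (L ^^ (T + j)) f y = (\<Sum>k=T..<T+j. d k y)"
        unfolding d_def using sum_Suc_diff'[of T "T + j" "\<lambda>k. - (L ^^ k) f y"] by simp
      also have "\<bar>\<dots>\<bar> \<le> (\<Sum>k=T..<T+j. \<bar>d k y\<bar>)" by (rule sum_abs)
      also have "\<dots> \<le> u y" unfolding u_def using j by (intro sum_mono2) auto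
      finally have "\<bar>(L ^^ (T + j)) f y\<bar> \<le> 1 / 8" using y' by linarith
      then show ?thesis by (metis add.commute comp_apply funpow_add)
    qed
    have shift: "(L ^^ n) f0 y = (L ^^ n) (indicat_real A) y - prob A" if "y \<in> space M" for n y
      using that
    proof (induction n arbitrary: y)
      case (Suc n)
      have "L ((L ^^ n) f0) y = L (\<lambda>y. (L ^^ n) (indicator A) y + (- prob A)) y"
        using Suc by (intro L_cong) auto
      also have "\<dots> = L ((L ^^ n) (indicator A)) y + (- prob A)"
        by (intro L_add_const Suc bm_intros A)
      finally show ?case by simp
    qed (simp add: f0_def)
    \<comment> \<open>The waiting argument starts from \<open>L^T f\<close>, which is small on
      \<open>G\<close> at all times up to \<open>T\<close>. Survival contributes a further 1/8,
      which makes the required 1/4.\<close>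
    have "\<bar>(L ^^ T) ((L ^^ T) f) x\<bar> \<le> killed G T x + 1 / 8"
    proof (rule L_pow_le_killed)
      show "\<bar>(L ^^ T) f y\<bar> \<le> 1" if "y \<in> space M" for y
        using le1[OF that, of "T + r"] by (simp add: f_def funpow_add)
      show "\<bar>(L ^^ j) ((L ^^ T) f) y\<bar> \<le> 1 / 8" if "y \<in> space M \<inter> G" "j \<le> T" for y j
        using that by (rule small)
    qed (simp_all add: G x bm_intros)
    moreover have "killed G T x \<le> 1 / 8"
    proof -
      have "16 * H * killed G T x \<le> real T * killed G T x"
        by (intro mult_right_mono T killed_nonneg x)
      also have "\<dots> \<le> 2 * H" using H by (intro killed_le[OF h G(1) x]) simp
      finally show ?thesis using H by simp
    qed
    moreover have "(L ^^ T) ((L ^^ T) f) x = (L ^^ (T + T + r)) (indicator A) x - prob A"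
      using shift[OF x, of "T + T + r"] unfolding f_def by (simp only: funpow_add o_apply)
    ultimately show "\<bar>(L ^^ (T + T + r)) (indicator A) x - prob A\<bar> \<le> 1 / 4"
      by linarith
  qed
qed

end

section \<open>Iterated and lazy kernels\<close>

text \<open>\<open>measure_of\<close> returns the given values only once they are known to form a
  measure. Writing the mixture as a fair coin toss between \<open>q\<close> and the point mass at
  \<open>x\<close> gives countable additivity and the integral formula at once.\<close>

lemma nn_integral_lazy_step:
  fixes x :: 'a
  assumes q: "prob_space q" "sets q = sets M" and x: "x \<in> space M"
  defines "N \<equiv> measure_of (space M) (sets M) (\<lambda>A. emeasure q A / 2 + indicator A x / 2)"
  shows "prob_space N" "sets N = sets M"
    "\<And>f. f \<in> borel_measurable M \<Longrightarrow> (\<integral>\<^sup>+y. f y \<partial>N) = (\<integral>\<^sup>+y. f y \<partial>q) / 2 + f x / 2"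
proof -
  define N' where "N' = measure_pmf (bernoulli_pmf (1 / 2)) \<bind> (\<lambda>b. if b then q else return M x)"
  have meas: "(\<lambda>b. if b then q else return M x) \<in> measure_pmf (bernoulli_pmf (1 / 2)) \<rightarrow>\<^sub>M prob_algebra M"
    using q x by (auto simp: space_prob_algebra prob_space_return)
  note meas' = measurable_prob_algebraD[OF meas]
  have nn: "(\<integral>\<^sup>+y. f y \<partial>N') = (\<integral>\<^sup>+y. f y \<partial>q) / 2 + f x / 2" if f: "f \<in> borel_measurable M" for f
    unfolding N'_def
    by (subst nn_integral_bind[OF f meas'])
       (simp add: nn_integral_return x f divide_ennreal_def mult.commute)
  have sets: "sets N' = sets M"
    unfolding N'_def by (rule sets_bind) (use q in auto)
  have prob: "prob_space N'"
    unfolding N'_def by (rule prob_space_bind'[OF _ meas]) (auto simp: space_prob_algebra measure_pmf.prob_space_axioms)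
  have "N = measure_of (space M) (sets M) (emeasure N')"
    unfolding N_def
  proof (rule measure_of_eq)
    fix A assume "A \<in> sigma_sets (space M) (sets M)"
    then have A: "A \<in> sets M" by (simp add: sets.sigma_sets_eq)
    then show "emeasure q A / 2 + indicator A x / 2 = emeasure N' A"
      using nn[of "indicator A"] q sets by (simp add: nn_integral_indicator)
  qed (rule sets.space_closed)
  also have "\<dots> = N'" using measure_of_of_measure[of N'] sets sets_eq_imp_space_eq[OF sets] by simp
  finally have N: "N = N'" .
  show "prob_space N" "sets N = sets M"
    "\<And>f. f \<in> borel_measurable M \<Longrightarrow> (\<integral>\<^sup>+y. f y \<partial>N) = (\<integral>\<^sup>+y. f y \<partial>q) / 2 + f x / 2"
    unfolding N by (fact prob sets nn)+
qed

context markov_kernel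
begin

lemma measurable_nn_integral_kernel [measurable]:
  "f \<in> borel_measurable M \<Longrightarrow> (\<lambda>x. \<integral>\<^sup>+y. f y \<partial>p x) \<in> borel_measurable M"
  by (rule measurable_compose[OF kernel_subprob nn_integral_measurable_subprob_algebra])

lemma kernel_iterate: "(\<lambda>x. iterate_kernel M p x t) \<in> M \<rightarrow>\<^sub>M prob_algebra M"
proof (induction t)
  case (Suc t)
  then show ?case unfolding iterate_kernel.simps by (rule measurable_bind_prob_space[OF _ kernel])
qed simp

lemma markov_kernel_iterate: "markov_kernel M (\<lambda>x. iterate_kernel M p x t)"
  by unfold_locales (rule kernel_iterate)

lemma nn_integral_iterate_Suc:
  assumes "f \<in> borel_measurable M" "x \<in> space M"
  shows "(\<integral>\<^sup>+y. f y \<partial>iterate_kernel M p x (Suc t)) = (\<integral>\<^sup>+y. \<integral>\<^sup>+z. f z \<partial>p y \<partial>iterate_kernel M p x t)"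
proof -
  interpret T: markov_kernel M "\<lambda>x. iterate_kernel M p x t" by (rule markov_kernel_iterate)
  have "p \<in> iterate_kernel M p x t \<rightarrow>\<^sub>M subprob_algebra M"
    using kernel_subprob measurable_cong_sets[OF T.sets_kernel[OF assms(2)] refl] by blast
  then show ?thesis unfolding iterate_kernel.simps by (intro nn_integral_bind[OF assms(1)])
qed

text \<open>Chapman-Kolmogorov with the first step split off, whereas \<open>iterate_kernel\<close>
  appends the last one. Reversibility of the iterates and the comparison with \<open>avoid\<close>
  need this form.\<close>

lemma nn_integral_iterate_Suc':
  assumes "f \<in> borel_measurable M" "x \<in> space M"
  shows "(\<integral>\<^sup>+y. f y \<partial>iterate_kernel M p x (Suc t)) = (\<integral>\<^sup>+y. \<integral>\<^sup>+z. f z \<partial>iterate_kernel M p y t \<partial>p x)"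
  using assms(1)
proof (induction t arbitrary: f)
  case 0
  then show ?case
    by (subst nn_integral_iterate_Suc)
       (auto simp: assms nn_integral_return space_kernel intro!: nn_integral_cong)
next
  case (Suc t)
  have "(\<integral>\<^sup>+y. f y \<partial>iterate_kernel M p x (Suc (Suc t))) = (\<integral>\<^sup>+y. \<integral>\<^sup>+z. \<integral>\<^sup>+w. f w \<partial>p z \<partial>iterate_kernel M p y t \<partial>p x)"
    using Suc.prems by (subst nn_integral_iterate_Suc[OF _ assms(2)]) (auto intro!: Suc.IH simp del: iterate_kernel.simps)
  also have "\<dots> = (\<integral>\<^sup>+y. \<integral>\<^sup>+z. f z \<partial>iterate_kernel M p y (Suc t) \<partial>p x)"
    using Suc.prems assms(2)
    by (intro nn_integral_cong nn_integral_iterate_Suc[symmetric]) (auto simp: space_kernel)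
  finally show ?case .
qed

lemma markov_op_iterate:
  assumes f: "f \<in> bounded_measurable M" and x: "x \<in> space M"
  shows "markov_op M (\<lambda>x. iterate_kernel M p x t) f x = (K ^^ t) f x"
  using f
proof (induction t arbitrary: f)
  case 0
  then show ?case using x by (simp add: markov_op_def integral_return bounded_measurableD)
next
  case (Suc t)
  interpret T: markov_kernel M "\<lambda>x. iterate_kernel M p x t" by (rule markov_kernel_iterate)
  interpret Tx: prob_space "iterate_kernel M p x t" by (rule T.prob_space_kernel[OF x])
  have p: "p \<in> iterate_kernel M p x t \<rightarrow>\<^sub>M subprob_algebra M"
    using kernel_subprob measurable_cong_sets[OF T.sets_kernel[OF x] refl] by blast
  obtain C where C: "\<And>x. x \<in> space M \<Longrightarrow> \<bar>f x\<bar> \<le> C" using Suc.prems by (metis bounded_measurableE)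
  have "(\<integral>y. f y \<partial>iterate_kernel M p x (Suc t)) = (\<integral>y. (\<integral>z. f z \<partial>p y) \<partial>iterate_kernel M p x t)"
    unfolding iterate_kernel.simps
    using Suc.prems C p prob_space.emeasure_space_1[OF prob_space_kernel]
    by (intro integral_bind[where K = M and B = C and B' = 1])
       (auto simp: T.space_kernel[OF x] Tx.finite_measure_axioms)
  also have "\<dots> = (\<integral>y. K f y \<partial>iterate_kernel M p x t)"
    by (intro Bochner_Integration.integral_cong) (auto simp: T.space_kernel[OF x] markov_op_def)
  also have "\<dots> = (K ^^ t) (K f) x"
    using Suc.IH[of "K f"] Suc.prems x
    by (simp add: bm_intros markov_op_def[of M "\<lambda>x. iterate_kernel M p x t"])
  finally show ?case
    using x by (simp add: markov_op_def[of M "\<lambda>x. iterate_kernel M p x (Suc t)"] funpow_swap1 del: iterate_kernel.simps)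
qed

lemma bounded_measurable_markov_pow [bm_intros]:
  "f \<in> bounded_measurable M \<Longrightarrow> (K ^^ n) f \<in> bounded_measurable M"
  by (induction n) (auto intro: bm_intros)

lemma measure_iterate:
  assumes "A \<in> sets M" "x \<in> space M"
  shows "measure (iterate_kernel M p x t) A = (K ^^ t) (indicator A) x"
proof -
  interpret T: markov_kernel M "\<lambda>x. iterate_kernel M p x t" by (rule markov_kernel_iterate)
  show ?thesis
    using markov_op_iterate[of "indicator A" x t] assms
    by (simp add: markov_op_def bm_intros T.sets_kernel)
qed

end

context reversible_kernel
begin

text \<open>The \<open>t\<close>-step kernel is moved across first, then the single step. This
  reverses their order, and the first-step form of the iterate restores it.\<close>

lemma reversible_kernel_iterate: "reversible_kernel M (\<lambda>x. iterate_kernel M p x t)"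
proof (induction t)
  case 0
  interpret T: markov_kernel M "\<lambda>x. iterate_kernel M p x 0" by (rule markov_kernel_iterate)
  show ?case
    by unfold_locales (auto intro!: nn_integral_cong simp: nn_integral_return mult.commute)
next
  case (Suc t)
  interpret T: reversible_kernel M "\<lambda>x. iterate_kernel M p x t" by (rule Suc)
  interpret S: markov_kernel M "\<lambda>x. iterate_kernel M p x (Suc t)" by (rule markov_kernel_iterate)
  show ?case
  proof unfold_locales
    fix f g :: "'a \<Rightarrow> ennreal" assume [measurable]: "f \<in> borel_measurable M" "g \<in> borel_measurable M"
    have "(\<integral>\<^sup>+x. f x * (\<integral>\<^sup>+y. g y \<partial>iterate_kernel M p x (Suc t)) \<partial>M) =
      (\<integral>\<^sup>+x. f x * (\<integral>\<^sup>+y. (\<integral>\<^sup>+z. g z \<partial>p y) \<partial>iterate_kernel M p x t) \<partial>M)"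
      by (intro nn_integral_cong arg_cong2[where f = times] nn_integral_iterate_Suc) auto
    also have "\<dots> = (\<integral>\<^sup>+x. (\<integral>\<^sup>+z. g z \<partial>p x) * (\<integral>\<^sup>+y. f y \<partial>iterate_kernel M p x t) \<partial>M)"
      by (intro T.reversible) auto
    also have "\<dots> = (\<integral>\<^sup>+x. (\<integral>\<^sup>+y. f y \<partial>iterate_kernel M p x t) * (\<integral>\<^sup>+z. g z \<partial>p x) \<partial>M)"
      by (simp add: mult.commute)
    also have "\<dots> = (\<integral>\<^sup>+x. g x * (\<integral>\<^sup>+y. (\<integral>\<^sup>+z. f z \<partial>iterate_kernel M p y t) \<partial>p x) \<partial>M)"
      by (intro reversible T.measurable_nn_integral_kernel) auto
    also have "\<dots> = (\<integral>\<^sup>+x. g x * (\<integral>\<^sup>+y. f y \<partial>iterate_kernel M p x (Suc t)) \<partial>M)"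
      by (intro nn_integral_cong arg_cong2[where f = times] nn_integral_iterate_Suc'[symmetric]) auto
    finally show "(\<integral>\<^sup>+x. f x * (\<integral>\<^sup>+y. g y \<partial>iterate_kernel M p x (Suc t)) \<partial>M) =
      (\<integral>\<^sup>+x. g x * (\<integral>\<^sup>+y. f y \<partial>iterate_kernel M p x (Suc t)) \<partial>M)" .
  qed
qed

definition lazy_step :: "'a \<Rightarrow> 'a measure" where
  "lazy_step x = measure_of (space M) (sets M) (\<lambda>A. emeasure (p x) A / 2 + indicator A x / 2)"

lemma
  assumes "x \<in> space M"
  shows prob_space_lazy_step: "prob_space (lazy_step x)"
    and sets_lazy_step: "sets (lazy_step x) = sets M"
    and nn_integral_lazy_step': "f \<in> borel_measurable M \<Longrightarrow>
      (\<integral>\<^sup>+y. f y \<partial>lazy_step x) = (\<integral>\<^sup>+y. f y \<partial>p x) / 2 + f x / 2"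
  unfolding lazy_step_def
  using nn_integral_lazy_step[OF prob_space_kernel[OF assms] sets_kernel[OF assms] assms] by auto

lemma reversible_kernel_lazy_step: "reversible_kernel M lazy_step"
proof unfold_locales
  show "lazy_step \<in> M \<rightarrow>\<^sub>M prob_algebra M"
  proof (rule measurable_prob_algebra_generated[OF sets.sigma_sets_eq[symmetric] sets.Int_stable sets.space_closed])
    fix A assume A: "A \<in> sets M"
    have "(\<lambda>x. emeasure (p x) A / 2 + indicator A x / 2) \<in> borel_measurable M"
      using A by measurable
    moreover have "emeasure (lazy_step x) A = emeasure (p x) A / 2 + indicator A x / 2" if "x \<in> space M" for x
      using nn_integral_lazy_step'[OF that, of "indicator A"] A that by (simp add: sets_lazy_step sets_kernel)
    ultimately show "(\<lambda>x. emeasure (lazy_step x) A) \<in> borel_measurable M"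
      by (subst measurable_cong) auto
  qed (auto simp: prob_space_lazy_step sets_lazy_step)
  fix f g :: "'a \<Rightarrow> ennreal" assume [measurable]: "f \<in> borel_measurable M" "g \<in> borel_measurable M"
  have *: "(\<integral>\<^sup>+x. f x * (\<integral>\<^sup>+y. g y \<partial>lazy_step x) \<partial>M) =
      (\<integral>\<^sup>+x. f x * (\<integral>\<^sup>+y. g y \<partial>p x) \<partial>M) / 2 + (\<integral>\<^sup>+x. f x * g x \<partial>M) / 2"
    if [measurable]: "f \<in> borel_measurable M" "g \<in> borel_measurable M" for f g
  proof -
    have "(\<integral>\<^sup>+x. f x * (\<integral>\<^sup>+y. g y \<partial>lazy_step x) \<partial>M) =
      (\<integral>\<^sup>+x. f x * (\<integral>\<^sup>+y. g y \<partial>p x) / 2 + f x * g x / 2 \<partial>M)"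
      by (intro nn_integral_cong) (simp add: nn_integral_lazy_step' ring_distribs divide_ennreal_def mult.assoc)
    then show ?thesis by (simp add: nn_integral_add nn_integral_divide)
  qed
  show "(\<integral>\<^sup>+x. f x * (\<integral>\<^sup>+y. g y \<partial>lazy_step x) \<partial>M) = (\<integral>\<^sup>+x. g x * (\<integral>\<^sup>+y. f y \<partial>lazy_step x) \<partial>M)"
    by (simp add: * reversible[of f g] mult.commute[of "f _" "g _"])
qed

lemma markov_op_lazy_step:
  assumes f: "f \<in> bounded_measurable M" and x: "x \<in> space M"
  shows "markov_op M lazy_step f x = L f x"
proof -
  interpret lz: reversible_kernel M lazy_step by (rule reversible_kernel_lazy_step)
  obtain C where C: "\<And>x. x \<in> space M \<Longrightarrow> \<bar>f x\<bar> \<le> C" using f by (metis bounded_measurableE)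
  \<comment> \<open>The extended integral formula covers nonnegative functions; the shift is removed
    at the end because both operators fix constants.\<close>
  define g where "g y = f y + C" for y
  have g [bm_intros]: "g \<in> bounded_measurable M" unfolding g_def[abs_def] by (intro bm_intros f)
  have g0: "0 \<le> g y" if "y \<in> space M" for y using C[OF that] by (simp add: g_def)
  have ints: "(\<integral>\<^sup>+y. ennreal (g y) \<partial>q) = ennreal (\<integral>y. g y \<partial>q)"
    if "prob_space q" "sets q = sets M" for q
  proof -
    interpret q: prob_space q by fact
    have "g \<in> bounded_measurable q" using g bounded_measurable_cong_sets[OF that(2)] by blast
    then show ?thesis using g0 sets_eq_imp_space_eq[OF that(2)]
      by (intro nn_integral_eq_integral q.bounded_measurable_integrable) auto
  qed
  have "ennreal (\<integral>y. g y \<partial>lazy_step x) = ennreal (\<integral>y. g y \<partial>p x) / 2 + ennreal (g x) / 2"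
    using nn_integral_lazy_step'[OF x, of "\<lambda>y. ennreal (g y)"] g x
    by (simp add: ints prob_space_lazy_step sets_lazy_step prob_space_kernel sets_kernel)
  also have "\<dots> = ennreal (((\<integral>y. g y \<partial>p x) + g x) / 2)"
  proof -
    have "0 \<le> (\<integral>y. g y \<partial>p x)" using g0 space_kernel[OF x] by (intro integral_nonneg_AE) auto
    then show ?thesis using g0[OF x]
      by (simp add: ennreal_divide_numeral[symmetric] add_divide_distrib)
  qed
  finally have "markov_op M lazy_step g x = L g x"
    using x g0 lz.space_kernel[OF x] space_kernel[OF x]
    by (subst (asm) ennreal_inj) (auto simp: markov_op_def L_def intro!: integral_nonneg_AE add_nonneg_nonneg)
  then show ?thesis
    using x f unfolding g_def by (simp add: L_add_const lz.markov_op_add bm_intros lz.markov_op_const)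
qed

lemma markov_op_lazy_step_pow:
  assumes f: "f \<in> bounded_measurable M" and x: "x \<in> space M"
  shows "(markov_op M lazy_step ^^ n) f x = (L ^^ n) f x"
  using x
proof (induction n arbitrary: x)
  case (Suc n)
  interpret lz: reversible_kernel M lazy_step by (rule reversible_kernel_lazy_step)
  have "markov_op M lazy_step ((markov_op M lazy_step ^^ n) f) = markov_op M lazy_step ((L ^^ n) f)"
    by (rule lz.markov_op_cong) (rule Suc.IH)
  then show ?case using Suc.prems by (simp add: markov_op_lazy_step bm_intros f)
qed simp

end

section \<open>Hitting times\<close>

context markov_kernel
begin

text \<open>Expectation of \<open>f\<close> at time \<open>n\<close> on the event that \<open>A\<close> is avoided at the times \<open>0, \<dots>, n\<close>.\<close>

primrec avoid :: "'a set \<Rightarrow> nat \<Rightarrow> ('a \<Rightarrow> ennreal) \<Rightarrow> 'a \<Rightarrow> ennreal" where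
  "avoid A 0 f = (\<lambda>x. indicator (space M - A) x * f x)"
| "avoid A (Suc n) f = (\<lambda>x. indicator (space M - A) x * (\<integral>\<^sup>+y. avoid A n f y \<partial>p x))"

lemma measurable_avoid [measurable]:
  assumes [measurable]: "A \<in> sets M" "f \<in> borel_measurable M"
  shows "avoid A n f \<in> borel_measurable M"
  by (induction n) auto

text \<open>\<open>avoid\<close> recurses on the first step of the chain, the Ionescu-Tulcea
  construction adds the last one; this translates between them.\<close>

lemma avoid_last:
  "avoid A (Suc n) f = avoid A n (\<lambda>y. \<integral>\<^sup>+z. indicator (space M - A) z * f z \<partial>p y)"
  by (induction n) simp_all

lemma avoid_outside: "x \<notin> space M - A \<Longrightarrow> avoid A n f x = 0"
  by (cases n) auto

text \<open>The Markov property at time \<open>n\<close>. That time is counted in both factors,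
  which is harmless for an indicator.\<close>

lemma avoid_add_le:
  assumes A [measurable]: "A \<in> sets M"
    and c: "\<And>y. y \<in> space M \<Longrightarrow> avoid A t (\<lambda>_. 1) y \<le> c" and x: "x \<in> space M"
  shows "avoid A (n + t) (\<lambda>_. 1) x \<le> c * avoid A n (\<lambda>_. 1) x"
  using x
proof (induction n arbitrary: x)
  case 0
  then show ?case using c[OF 0] avoid_outside[of x A t] by (cases "x \<in> A") auto
next
  case (Suc n)
  have "(\<integral>\<^sup>+y. avoid A (n + t) (\<lambda>_. 1) y \<partial>p x) \<le> (\<integral>\<^sup>+y. c * avoid A n (\<lambda>_. 1) y \<partial>p x)"
    using Suc space_kernel by (intro nn_integral_mono) auto
  also have "\<dots> = c * (\<integral>\<^sup>+y. avoid A n (\<lambda>_. 1) y \<partial>p x)"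
    by (intro nn_integral_cmult)
      (simp add: measurable_cong_sets[OF sets_kernel[OF Suc.prems] refl])
  finally have "indicator (space M - A) x * (\<integral>\<^sup>+y. avoid A (n + t) (\<lambda>_. 1) y \<partial>p x)
    \<le> indicator (space M - A) x * (c * (\<integral>\<^sup>+y. avoid A n (\<lambda>_. 1) y \<partial>p x))"
    by (rule mult_left_mono) simp
  then show ?case by (simp add: mult.left_commute)
qed

lemma avoid_le_1:
  assumes "x \<in> space M"
  shows "avoid A n (\<lambda>_. 1) x \<le> 1"
  using assms
proof (induction n arbitrary: x)
  case (Suc n)
  have "(\<integral>\<^sup>+y. avoid A n (\<lambda>_. 1) y \<partial>p x) \<le> (\<integral>\<^sup>+y. 1 \<partial>p x)"
    using Suc space_kernel by (intro nn_integral_mono) auto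
  then show ?case
    using prob_space.emeasure_space_1[OF prob_space_kernel[OF Suc.prems]] by (auto simp: indicator_def)
qed (auto simp: indicator_def)

lemma avoid_antimono:
  assumes "A \<in> sets M" "x \<in> space M" "m \<le> n"
  shows "avoid A n (\<lambda>_. 1) x \<le> avoid A m (\<lambda>_. 1) x"
  using avoid_add_le[OF assms(1) avoid_le_1 assms(2), of m "n - m"] assms(3) by simp

lemma avoid_le_iterate:
  assumes A: "A \<in> sets M" and x: "x \<in> space M"
  shows "avoid A n (\<lambda>_. 1) x \<le> emeasure (iterate_kernel M p x n) (space M - A)"
  using x
proof (induction n arbitrary: x)
  case 0
  then show ?case using A by simp
next
  case (Suc n)
  interpret T: markov_kernel M "\<lambda>x. iterate_kernel M p x n" by (rule markov_kernel_iterate)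
  interpret S: markov_kernel M "\<lambda>x. iterate_kernel M p x (Suc n)" by (rule markov_kernel_iterate)
  have "avoid A (Suc n) (\<lambda>_. 1) x \<le> (\<integral>\<^sup>+y. avoid A n (\<lambda>_. 1) y \<partial>p x)"
    by (simp add: indicator_def)
  also have "\<dots> \<le> (\<integral>\<^sup>+y. emeasure (iterate_kernel M p y n) (space M - A) \<partial>p x)"
    using Suc space_kernel by (intro nn_integral_mono) auto
  also have "\<dots> = (\<integral>\<^sup>+y. \<integral>\<^sup>+z. indicator (space M - A) z \<partial>iterate_kernel M p y n \<partial>p x)"
    using A Suc.prems by (intro nn_integral_cong) (auto simp: space_kernel T.sets_kernel)
  also have "\<dots> = (\<integral>\<^sup>+z. indicator (space M - A) z \<partial>iterate_kernel M p x (Suc n))"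
    using A Suc.prems by (intro nn_integral_iterate_Suc'[symmetric]) auto
  also have "\<dots> = emeasure (iterate_kernel M p x (Suc n)) (space M - A)"
    using A S.sets_kernel[OF Suc.prems] by (intro nn_integral_indicator) auto
  finally show ?case .
qed

section \<open>Law of the trajectory and expected hitting time\<close>

context
  fixes h :: "'a kernel" and x :: 'a
  assumes h1: "\<And>y. h y 1 = p y" and x: "x \<in> space M"
begin

text \<open>\<open>path_law\<close> reads only \<open>h _ 1\<close>. Requiring this alone to equal
  \<open>p\<close> covers skeletons, which are given for all times at once.\<close>

lemma Ionescu_Tulcea_path_law:
  "Ionescu_Tulcea (\<lambda>n \<omega>. case n of 0 \<Rightarrow> return M x | Suc m \<Rightarrow> h (\<omega> m) 1) (\<lambda>_. M)"
  unfolding Ionescu_Tulcea_def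
proof (intro conjI allI impI)
  fix i
  show "(\<lambda>\<omega>. case i of 0 \<Rightarrow> return M x | Suc m \<Rightarrow> h (\<omega> m) 1) \<in> PiM {0..<i} (\<lambda>_. M) \<rightarrow>\<^sub>M subprob_algebra M"
  proof (cases i)
    case 0
    have "return M x \<in> space (subprob_algebra M)"
      using x by (simp add: space_subprob_algebra subprob_space_return)
    then show ?thesis using 0 by simp
  next
    case (Suc m)
    have "(\<lambda>\<omega>. p (\<omega> m)) \<in> PiM {0..<Suc m} (\<lambda>_. M) \<rightarrow>\<^sub>M subprob_algebra M"
      by (rule measurable_compose[OF measurable_component_singleton[of m "{0..<Suc m}" "\<lambda>_. M"] kernel_subprob]) simp
    then show ?thesis using Suc by (simp add: h1[unfolded One_nat_def])
  qed
next
  fix i and \<omega> :: "nat \<Rightarrow> 'a" assume "\<omega> \<in> space (PiM {0..<i} (\<lambda>_. M))"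
  then show "prob_space (case i of 0 \<Rightarrow> return M x | Suc m \<Rightarrow> h (\<omega> m) 1)"
    using x by (cases i) (auto simp: prob_space_return h1[unfolded One_nat_def] space_PiM PiE_iff intro!: prob_space_kernel)
qed

interpretation IT: Ionescu_Tulcea "\<lambda>n \<omega>. case n of 0 \<Rightarrow> return M x | Suc m \<Rightarrow> h (\<omega> m) 1" "\<lambda>_. M"
  by (rule Ionescu_Tulcea_path_law)

lemma path_law_eq: "path_law M h x = IT.PF.lim"
  by (simp add: path_law_def)

text \<open>The times 0 to \<open>n\<close> are \<open>Suc n\<close> coordinates. Integrating out
  the last one replaces \<open>f\<close> by its \<open>p\<close>-average off \<open>A\<close>, hence
  the induction over all \<open>f\<close>.\<close>

lemma nn_integral_C_avoid:
  assumes A [measurable]: "A \<in> sets M" and f: "f \<in> borel_measurable M"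
  shows "(\<integral>\<^sup>+\<omega>. (\<Prod>i\<le>n. indicator (space M - A) (\<omega> i)) * f (\<omega> n) \<partial>IT.C 0 (Suc n) (\<lambda>_. undefined)) = avoid A n f x"
  using f
proof (induction n arbitrary: f)
  case 0
  note [measurable] = 0
  \<comment> \<open>The construction starts from the single point of the empty product.\<close>
  let ?u = "\<lambda>_::nat. undefined :: 'a"
  have u: "?u \<in> space (PiM {} (\<lambda>_. M))" by (simp add: space_PiM)
  have "(\<integral>\<^sup>+\<omega>. (\<Prod>i\<le>0. indicator (space M - A) (\<omega> i)) * f (\<omega> 0) \<partial>IT.C 0 (Suc 0) ?u)
    = (\<integral>\<^sup>+\<omega>. \<integral>\<^sup>+\<omega>'. indicator (space M - A) (\<omega>' 0) * f (\<omega>' 0) \<partial>IT.eP 0 \<omega> \<partial>return (PiM {} (\<lambda>_. M)) ?u)"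
    unfolding IT.C.simps
    by (subst nn_integral_bind[where B = "PiM {0..<Suc 0} (\<lambda>_. M)"])
       (use IT.measurable_eP[of 0] in \<open>simp_all\<close>)
  also have "\<dots> = (\<integral>\<^sup>+\<omega>'. indicator (space M - A) (\<omega>' 0) * f (\<omega>' 0) \<partial>IT.eP 0 ?u)"
    using u by (subst nn_integral_return) (use IT.measurable_eP[of 0] in \<open>auto intro!: measurable_compose[OF _ nn_integral_measurable_subprob_algebra]\<close>)
  also have "\<dots> = (\<integral>\<^sup>+y. indicator (space M - A) y * f y \<partial>return M x)"
    using u by (subst IT.nn_integral_eP) simp_all
  also have "\<dots> = avoid A 0 f x" using x by (subst nn_integral_return) auto
  finally show ?case .
next
  case (Suc n)
  note [measurable] = Suc.prems
  let ?u = "\<lambda>_::nat. undefined :: 'a"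
  define g where "g y = (\<integral>\<^sup>+z. indicator (space M - A) z * f z \<partial>p y)" for y
  have g [measurable]: "g \<in> borel_measurable M" unfolding g_def[abs_def] by measurable
  have C_cong: "IT.C 0 (Suc n) ?u \<rightarrow>\<^sub>M N = PiM {0..<Suc n} (\<lambda>_. M) \<rightarrow>\<^sub>M N" for N :: "(nat \<Rightarrow> 'a) measure measure"
    using measurable_cong_sets[OF IT.sets_C[of ?u 0 "Suc n"] refl] by (simp add: space_PiM)
  have "(\<integral>\<^sup>+\<omega>. (\<Prod>i\<le>Suc n. indicator (space M - A) (\<omega> i)) * f (\<omega> (Suc n)) \<partial>IT.C 0 (Suc (Suc n)) ?u)
    = (\<integral>\<^sup>+\<omega>. \<integral>\<^sup>+\<omega>'. (\<Prod>i\<le>Suc n. indicator (space M - A) (\<omega>' i)) * f (\<omega>' (Suc n)) \<partial>IT.eP (Suc n) \<omega> \<partial>IT.C 0 (Suc n) ?u)"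
    unfolding IT.C.simps(2)[of 0 "Suc n"] add_0
    by (subst nn_integral_bind[where B = "PiM {0..<Suc (Suc n)} (\<lambda>_. M)"])
       (use IT.measurable_eP[of "Suc n"] C_cong in \<open>simp_all del: IT.C.simps\<close>)
  also have "\<dots> = (\<integral>\<^sup>+\<omega>. (\<Prod>i\<le>n. indicator (space M - A) (\<omega> i)) * g (\<omega> n) \<partial>IT.C 0 (Suc n) ?u)"
  proof (rule nn_integral_cong)
    fix \<omega> assume "\<omega> \<in> space (IT.C 0 (Suc n) ?u)"
    then have \<omega>: "\<omega> \<in> space (PiM {0..<Suc n} (\<lambda>_. M))" by (subst (asm) IT.space_C) (auto simp: space_PiM)
    then have \<omega>n: "\<omega> n \<in> space M" by (auto simp: space_PiM PiE_iff)
    have "(\<integral>\<^sup>+\<omega>'. (\<Prod>i\<le>Suc n. indicator (space M - A) (\<omega>' i)) * f (\<omega>' (Suc n)) \<partial>IT.eP (Suc n) \<omega>)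
      = (\<integral>\<^sup>+y. (\<Prod>i\<le>Suc n. indicator (space M - A) (fun_upd \<omega> (Suc n) y i)) * f y \<partial>p (\<omega> n))"
      by (subst IT.nn_integral_eP[OF \<omega>]) (auto simp: h1[unfolded One_nat_def])
    also have "\<dots> = (\<integral>\<^sup>+y. (\<Prod>i\<le>n. indicator (space M - A) (\<omega> i)) * (indicator (space M - A) y * f y) \<partial>p (\<omega> n))"
      by (intro nn_integral_cong) (simp add: mult.assoc)
    also have "\<dots> = (\<Prod>i\<le>n. indicator (space M - A) (\<omega> i)) * g (\<omega> n)"
      unfolding g_def by (intro nn_integral_cmult) (simp add: measurable_cong_sets[OF sets_kernel[OF \<omega>n] refl])
    finally show "(\<integral>\<^sup>+\<omega>'. (\<Prod>i\<le>Suc n. indicator (space M - A) (\<omega>' i)) * f (\<omega>' (Suc n)) \<partial>IT.eP (Suc n) \<omega>) =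
      (\<Prod>i\<le>n. indicator (space M - A) (\<omega> i)) * g (\<omega> n)" .
  qed
  also have "\<dots> = avoid A n g x" by (rule Suc.IH) simp
  finally show ?case by (simp only: avoid_last g_def[abs_def])
qed

lemma emeasure_path_law_avoid:
  assumes A [measurable]: "A \<in> sets M"
  shows "emeasure (path_law M h x) {\<omega> \<in> space (path_law M h x). \<forall>i\<le>n. \<omega> i \<notin> A} = avoid A n (\<lambda>_. 1) x"
proof -
  let ?u = "\<lambda>_::nat. undefined :: 'a"
  define X where "X = (\<Pi>\<^sub>E i\<in>{0..<Suc n}. space M - A)"
  have X [measurable]: "X \<in> sets (PiM {0..<Suc n} (\<lambda>_. M))"
    unfolding X_def by (rule sets_PiM_I_finite) auto
  have "{\<omega> \<in> space (path_law M h x). \<forall>i\<le>n. \<omega> i \<notin> A} = prod_emb UNIV (\<lambda>_. M) {0..<Suc n} X"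
    by (auto simp: path_law_eq prod_emb_def X_def space_PiM PiE_iff)
  then have "emeasure (path_law M h x) {\<omega> \<in> space (path_law M h x). \<forall>i\<le>n. \<omega> i \<notin> A} =
    emeasure (IT.CI {0..<Suc n}) X"
    using IT.lim[OF _ X] by (simp add: path_law_eq)
  also have "\<dots> = emeasure (IT.C 0 (Suc n) ?u) (prod_emb {0..<Suc n} (\<lambda>_. M) {0..<Suc n} X)"
    by (rule IT.emeasure_CI) auto
  also have "prod_emb {0..<Suc n} (\<lambda>_. M) {0..<Suc n} X = X"
    by (rule prod_emb_id) (auto simp: X_def PiE_iff)
  also have "emeasure (IT.C 0 (Suc n) ?u) X = (\<integral>\<^sup>+\<omega>. indicator X \<omega> \<partial>IT.C 0 (Suc n) ?u)"
    using X IT.sets_C[of ?u 0 "Suc n"] by (intro nn_integral_indicator[symmetric]) (auto simp: space_PiM)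
  also have "\<dots> = (\<integral>\<^sup>+\<omega>. (\<Prod>i\<le>n. indicator (space M - A) (\<omega> i)) * 1 \<partial>IT.C 0 (Suc n) ?u)"
  proof (rule nn_integral_cong)
    fix \<omega> assume "\<omega> \<in> space (IT.C 0 (Suc n) ?u)"
    then have "\<omega> \<in> space (PiM {0..<Suc n} (\<lambda>_. M))" by (subst (asm) IT.space_C) (auto simp: space_PiM)
    then have "\<omega> \<in> X \<longleftrightarrow> (\<forall>i\<le>n. \<omega> i \<in> space M - A)" by (auto simp: X_def space_PiM PiE_iff)
    then show "indicator X \<omega> = (\<Prod>i\<le>n. indicator (space M - A) (\<omega> i)) * (1::ennreal)"
      by (cases "\<omega> \<in> X") (auto simp: indicator_def)
  qed
  also have "\<dots> = avoid A n (\<lambda>_. 1) x" by (rule nn_integral_C_avoid) auto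
  finally show ?thesis .
qed

lemma less_hitting_time_iff: "enat n < hitting_time A \<omega> \<longleftrightarrow> (\<forall>i\<le>n. \<omega> i \<notin> A)"
proof -
  have "enat n < hitting_time A \<omega> \<longleftrightarrow> enat (Suc n) \<le> hitting_time A \<omega>" by (simp add: Suc_ile_eq)
  also have "\<dots> \<longleftrightarrow> (\<forall>i. \<omega> i \<in> A \<longrightarrow> Suc n \<le> i)"
    unfolding hitting_time_def by (auto simp: le_Inf_iff)
  also have "\<dots> \<longleftrightarrow> (\<forall>i\<le>n. \<omega> i \<notin> A)" by (auto simp: not_less_eq_eq[symmetric])
  finally show ?thesis .
qed

text \<open>Tail-sum formula: the expectation is the sum over \<open>n\<close> of the probabilities
  that the hitting time exceeds \<open>n\<close>. A start inside \<open>A\<close> contributes 0, in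
  agreement with counting from time 0.\<close>

lemma expected_hitting_time:
  assumes A [measurable]: "A \<in> sets M"
  shows "(\<integral>\<^sup>+\<omega>. ennreal_of_enat (hitting_time A \<omega>) \<partial>path_law M h x) = (\<Sum>n. avoid A n (\<lambda>_. 1) x)"
proof -
  have sets: "sets (path_law M h x) = sets (PiM UNIV (\<lambda>_. M))" by (simp add: path_law_eq)
  have comp: "(\<lambda>\<omega>. \<omega> i) \<in> path_law M h x \<rightarrow>\<^sub>M M" for i :: nat
    using measurable_cong_sets[OF sets refl] measurable_component_singleton[of i UNIV "\<lambda>_. M"] by blast
  have "hitting_time A \<in> path_law M h x \<rightarrow>\<^sub>M count_space UNIV"
  \<comment> \<open>The range is countable, so single values suffice, and each value, including
    infinity, is determined by the tail events \<open>lt\<close>.\<close>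
  proof (subst measurable_count_space_eq2_countable, intro conjI ballI)
    have lt: "{\<omega> \<in> space (path_law M h x). enat n < hitting_time A \<omega>} \<in> sets (path_law M h x)" for n
      unfolding less_hitting_time_iff using comp by measurable
    fix a :: enat
    show "hitting_time A -` {a} \<inter> space (path_law M h x) \<in> sets (path_law M h x)"
    proof (cases a)
      case (enat i)
      have "hitting_time A \<omega> = enat i \<longleftrightarrow> \<not> enat i < hitting_time A \<omega> \<and> (\<forall>j<i. enat j < hitting_time A \<omega>)" for \<omega>
        by (cases "hitting_time A \<omega>") (auto simp: not_less, metis less_irrefl_nat linorder_le_less_linear le_antisym)
      then have "hitting_time A -` {a} \<inter> space (path_law M h x) =
        {\<omega> \<in> space (path_law M h x). \<not> enat i < hitting_time A \<omega> \<and> (\<forall>j<i. enat j < hitting_time A \<omega>)}"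
        using enat by auto
      then show ?thesis using lt by simp
    next
      case infinity
      have "hitting_time A \<omega> = \<infinity> \<longleftrightarrow> (\<forall>n. enat n < hitting_time A \<omega>)" for \<omega>
        by (cases "hitting_time A \<omega>") auto
      then have "hitting_time A -` {a} \<inter> space (path_law M h x) =
        {\<omega> \<in> space (path_law M h x). \<forall>n. enat n < hitting_time A \<omega>}"
        using infinity by auto
      then show ?thesis using lt by simp
    qed
  qed auto
  then have "(\<integral>\<^sup>+\<omega>. ennreal_of_enat (hitting_time A \<omega>) \<partial>path_law M h x) =
    (\<Sum>n. emeasure (path_law M h x) {\<omega> \<in> space (path_law M h x). enat n < hitting_time A \<omega>})"
    by (rule nn_integral_enat_function)
  then show ?thesis by (simp add: less_hitting_time_iff emeasure_path_law_avoid)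
qed

end

end

section \<open>Total variation bounds as bounds over all sets and starting points\<close>

lemma tv_dist_le_iff:
  assumes "prob_space \<mu>" "prob_space \<nu>"
  shows "tv_dist \<mu> \<nu> \<le> c \<longleftrightarrow> (\<forall>A\<in>sets \<nu>. \<bar>measure \<mu> A - measure \<nu> A\<bar> \<le> c)"
proof -
  have "\<bar>measure \<mu> A - measure \<nu> A\<bar> \<le> 1" for A
    using prob_space.prob_le_1[OF assms(1), of A] prob_space.prob_le_1[OF assms(2), of A]
      measure_nonneg[of \<mu> A] measure_nonneg[of \<nu> A] by linarith
  then have "bdd_above ((\<lambda>A. \<bar>measure \<mu> A - measure \<nu> A\<bar>) ` sets \<nu>)"
    by (intro bdd_aboveI2)
  then show ?thesis unfolding tv_dist_def by (subst cSUP_le_iff) auto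
qed

text \<open>These suprema are taken in the reals: boundedness by 1 and a nonempty space are what
  makes them genuine suprema.\<close>

lemma SUP_tv_dist_le_iff:
  assumes \<mu>: "prob_space \<mu>" and h: "\<And>x. x \<in> space \<mu> \<Longrightarrow> prob_space (h x)"
  shows "(SUP x\<in>space \<mu>. tv_dist (h x) \<mu>) \<le> c \<longleftrightarrow>
    (\<forall>x\<in>space \<mu>. \<forall>A\<in>sets \<mu>. \<bar>measure (h x) A - measure \<mu> A\<bar> \<le> c)"
proof -
  have "tv_dist (h x) \<mu> \<le> 1" if "x \<in> space \<mu>" for x
    unfolding tv_dist_le_iff[OF h[OF that] \<mu>]
    using prob_space.prob_le_1[OF h[OF that]] prob_space.prob_le_1[OF \<mu>]
    by (auto simp: abs_le_iff intro: order_trans[OF _ add_increasing2] simp: algebra_simps add_increasing2)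
  then have "bdd_above ((\<lambda>x. tv_dist (h x) \<mu>) ` space \<mu>)" by (intro bdd_aboveI2)
  then show ?thesis
    using prob_space.not_empty[OF \<mu>] by (subst cSUP_le_iff) (auto simp: tv_dist_le_iff h \<mu>)
qed

section \<open>First-step analysis, geometric decay and contraction of oscillation\<close>

context markov_kernel
begin

text \<open>First-step analysis: splitting the series at time 0 gives \<open>h = 1 + K h\<close> off
  \<open>A\<close>. The equation is derived in \<open>ennreal\<close> and descends to the reals
  because \<open>H\<close> keeps everything finite.\<close>

lemma hitting_bound_expected_hitting_time:
  assumes rev: "reversible_kernel M p" and A [measurable]: "A \<in> sets M"
    and H: "\<And>x. x \<in> space M \<Longrightarrow> (\<Sum>n. avoid A n (\<lambda>_. 1) x) \<le> ennreal H" "0 \<le> H"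
  shows "\<exists>h. reversible_kernel.hitting_bound M p A H h"
proof -
  interpret reversible_kernel M p by (rule rev)
  define S where "S x = (\<Sum>n. avoid A n (\<lambda>_. 1) x)" for x
  define h where "h x = enn2real (S x)" for x
  have [measurable]: "S \<in> borel_measurable M" unfolding S_def[abs_def] by measurable
  have S: "S x = ennreal (h x)" "h x \<le> H" "0 \<le> h x" if "x \<in> space M" for x
  proof -
    have "S x \<le> ennreal H" using H(1)[OF that] by (simp add: S_def)
    moreover from this have "S x < top" by (rule le_less_trans) simp
    ultimately show "S x = ennreal (h x)" "h x \<le> H" "0 \<le> h x"
      using H(2) by (auto simp: h_def intro!: enn2real_leI)
  qed
  have h: "h \<in> bounded_measurable M"
    using S by (intro bounded_measurableI[of _ _ H]) (auto simp: h_def[abs_def])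
  have "hitting_bound A H h"
    unfolding hitting_bound_def
  proof (intro conjI h ballI)
    show "h x = 0" if "x \<in> space M \<inter> A" for x
      using that by (simp add: h_def S_def avoid_outside)
    fix x assume x: "x \<in> space M - A"
    then show "h x \<le> H" using S by simp
    have "ennreal (h x) = avoid A 0 (\<lambda>_. 1) x + (\<Sum>n. avoid A (Suc n) (\<lambda>_. 1) x)"
      using S(1)[of x] x unfolding S_def
      by (simp add: suminf_offset[of "\<lambda>n. avoid A n (\<lambda>_. 1) x" 1] add.commute del: avoid.simps)
    also have "\<dots> = 1 + (\<Sum>n. \<integral>\<^sup>+y. avoid A n (\<lambda>_. 1) y \<partial>p x)" using x by simp
    also have "(\<Sum>n. \<integral>\<^sup>+y. avoid A n (\<lambda>_. 1) y \<partial>p x) = (\<integral>\<^sup>+y. S y \<partial>p x)"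
      unfolding S_def using x
      by (intro nn_integral_suminf[symmetric]) (simp add: measurable_cong_sets[OF sets_kernel refl])
    also have "\<dots> = (\<integral>\<^sup>+y. ennreal (h y) \<partial>p x)"
      using S x by (intro nn_integral_cong) (auto simp: space_kernel)
    also have "\<dots> = ennreal (K h x)"
      using S x h by (subst nn_integral_eq_integral) (auto simp: space_kernel markov_op_def intro!: integrable_kernel)
    finally have eq: "ennreal (h x) = 1 + ennreal (K h x)" .
    have nonneg: "0 \<le> K h x" using S by (intro markov_op_nonneg) auto
    then have "ennreal (h x) = ennreal (1 + K h x)" using eq by (simp add: ennreal_plus)
    then have "h x = 1 + K h x" using S(3)[of x] x nonneg by (subst (asm) ennreal_inj) auto
    then show "1 \<le> h x" "K h x \<le> h x - 1" using nonneg by auto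
  qed
  then show ?thesis by blast
qed

text \<open>Time is cut into blocks of length \<open>n\<close>; each block is survived with
  conditional probability at most \<open>q\<close>, so the sum is at most \<open>n\<close> times a
  geometric series.\<close>

lemma suminf_avoid_le:
  assumes A: "A \<in> sets M" and q: "\<And>x. x \<in> space M \<Longrightarrow> avoid A n (\<lambda>_. 1) x \<le> ennreal q" "0 \<le> q" "q < 1"
    and n: "0 < n" and x: "x \<in> space M"
  shows "(\<Sum>i. avoid A i (\<lambda>_. 1) x) \<le> ennreal (n / (1 - q))"
proof -
  let ?v = "\<lambda>i. avoid A i (\<lambda>_. 1) x"
  have pow: "avoid A (j * n) (\<lambda>_. 1) x \<le> ennreal (q ^ j)" if "x \<in> space M" for x j
    using that
  proof (induction j arbitrary: x)
    case 0
    then show ?case using avoid_le_1[OF 0, of A 0] by simp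
  next
    case (Suc j)
    have "avoid A (n + j * n) (\<lambda>_. 1) x \<le> ennreal (q ^ j) * avoid A n (\<lambda>_. 1) x"
      by (rule avoid_add_le[OF A Suc.IH Suc.prems])
    also have "\<dots> \<le> ennreal (q ^ j) * ennreal q" by (intro mult_left_mono q Suc) simp
    finally show ?case using q by (simp add: ennreal_mult[symmetric] mult.commute)
  qed
  have "(\<Sum>i<N. ?v i) \<le> ennreal (n / (1 - q))" for N
  proof -
    have "(\<Sum>i<N. ?v i) \<le> (\<Sum>i<N * n. ?v i)" using n by (intro sum_mono2) auto
    also have "\<dots> = (\<Sum>j<N. \<Sum>i=j * n..<j * n + n. ?v i)" by (rule sum.nat_group[symmetric])
    also have "\<dots> \<le> (\<Sum>j<N. \<Sum>i=j * n..<j * n + n. ennreal (q ^ j))"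
      by (intro sum_mono order_trans[OF avoid_antimono[OF A x] pow[OF x]]) auto
    also have "\<dots> = ennreal (\<Sum>j<N. n * q ^ j)"
      using q by (subst sum_ennreal[symmetric]) (auto simp: ennreal_mult ennreal_of_nat_eq_real_of_nat)
    also have "\<dots> \<le> ennreal (n / (1 - q))"
    proof (rule ennreal_leI)
      have "(\<Sum>j<N. n * q ^ j) = n * ((1 - q ^ N) / (1 - q))"
        using q by (simp add: sum_distrib_left[symmetric] sum_gp_strict)
      also have "\<dots> \<le> n * (1 / (1 - q))" using q by (intro mult_left_mono divide_right_mono) auto
      finally show "(\<Sum>j<N. n * q ^ j) \<le> n / (1 - q)" by simp
    qed
    finally show ?thesis .
  qed
  then show ?thesis by (subst suminf_eq_SUP) (rule SUP_least)
qed

text \<open>Cut at the midpoint \<open>c\<close>. One of the two sides has measure at least 1/2 and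
  is therefore charged with at least 1/4 from every \<open>x\<close>. A quarter of the mass lies
  half an interval away from one end, which improves that end by \<open>(b - a) / 8\<close>.\<close>

lemma oscillation_contraction:
  assumes tv: "\<And>x S. x \<in> space M \<Longrightarrow> S \<in> sets M \<Longrightarrow> \<bar>measure (p x) S - prob S\<bar> \<le> 1 / 4"
    and f: "f \<in> bounded_measurable M" and ab: "\<And>x. x \<in> space M \<Longrightarrow> a \<le> f x \<and> f x \<le> b"
  obtains a' b' where "\<And>x. x \<in> space M \<Longrightarrow> a' \<le> K f x \<and> K f x \<le> b'" "b' - a' = 7 / 8 * (b - a)"
proof -
  have [measurable]: "f \<in> borel_measurable M" using f by auto
  define c where "c = (a + b) / 2"
  define S where "S = {x \<in> space M. c \<le> f x}"
  have S: "S \<in> sets M" unfolding S_def by measurable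
  have "a \<le> b" using ab not_empty by force
  have K_ind: "K (\<lambda>y. u + v * indicator T y) x = u + v * measure (p x) T" if "T \<in> sets M" "x \<in> space M" for u v T x
    using that by (simp add: markov_op_add markov_op_cmult markov_op_const bm_intros)
      (simp add: markov_op_def sets_kernel)
  show thesis
  proof (cases "1 / 2 \<le> prob S")
    case True
    show thesis
    proof (rule that[of "a + (b - a) / 8" b])
      fix x assume x: "x \<in> space M"
      have "a + (b - a) / 8 = a + (c - a) * (1 / 4)" by (simp add: c_def field_simps)
      also have "\<dots> \<le> a + (c - a) * measure (p x) S"
      proof (intro add_left_mono mult_left_mono)
        show "1 / 4 \<le> measure (p x) S" using tv[OF x S] True by arith
      qed (use \<open>a \<le> b\<close> in \<open>simp add: c_def\<close>)
      also have "\<dots> = K (\<lambda>y. a + (c - a) * indicator S y) x" by (simp add: K_ind S x)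
      also have "\<dots> \<le> K f x"
        using ab by (intro markov_op_mono x f bm_intros S) (auto simp: S_def indicator_def)
      finally show "a + (b - a) / 8 \<le> K f x \<and> K f x \<le> b" using markov_op_bounds[OF x f ab] by simp
    qed (simp add: field_simps)
  next
    case False
    define T where "T = space M - S"
    have T: "T \<in> sets M" "1 / 2 \<le> prob T" using S False by (auto simp: T_def prob_compl)
    show thesis
    proof (rule that[of a "b - (b - a) / 8"])
      fix x assume x: "x \<in> space M"
      have "K f x \<le> K (\<lambda>y. b + (c - b) * indicator T y) x"
        using ab by (intro markov_op_mono x f bm_intros T) (auto simp: T_def S_def indicator_def)
      also have "\<dots> = b + (c - b) * measure (p x) T" by (simp add: K_ind T x)
      also have "\<dots> \<le> b + (c - b) * (1 / 4)"
      proof (intro add_left_mono mult_left_mono_neg)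
        show "1 / 4 \<le> measure (p x) T" using tv[OF x T(1)] T(2) by arith
      qed (use \<open>a \<le> b\<close> in \<open>simp add: c_def\<close>)
      also have "\<dots> = b - (b - a) / 8" by (simp add: c_def field_simps)
      finally show "a \<le> K f x \<and> K f x \<le> b - (b - a) / 8" using markov_op_bounds[OF x f ab] by simp
    qed (simp add: field_simps)
  qed
qed

end

section \<open>The two inequalities between mixing and hitting times\<close>

context reversible_kernel
begin

lemma integral_markov_op_pow:
  assumes "f \<in> bounded_measurable M"
  shows "(\<integral>x. (K ^^ n) f x \<partial>M) = (\<integral>x. f x \<partial>M)"
  by (induction n) (simp_all add: integral_markov_op bm_intros assms)

text \<open>The values of \<open>K^n\<close> applied to the indicator lie in an interval of length
  (7/8)^n, and their preserved mean \<open>prob A\<close> cannot exceed its upper end.\<close>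

lemma markov_op_pow_lower:
  assumes tv: "\<And>x S. x \<in> space M \<Longrightarrow> S \<in> sets M \<Longrightarrow> \<bar>measure (p x) S - prob S\<bar> \<le> 1 / 4"
    and A: "A \<in> sets M" and x: "x \<in> space M"
  shows "prob A - (7 / 8) ^ n \<le> (K ^^ n) (indicator A) x"
proof -
  have "\<exists>a b. (\<forall>x\<in>space M. a \<le> (K ^^ n) (indicator A) x \<and> (K ^^ n) (indicator A) x \<le> b) \<and> b - a = (7 / 8) ^ n"
  proof (induction n)
    case 0
    show ?case by (intro exI[of _ 0] exI[of _ 1]) (auto simp: indicator_def)
  next
    case (Suc n)
    then obtain a b where ab: "\<And>x. x \<in> space M \<Longrightarrow> a \<le> (K ^^ n) (indicator A) x \<and> (K ^^ n) (indicator A) x \<le> b"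
      "b - a = (7 / 8) ^ n" by blast
    obtain a' b' where "\<And>x. x \<in> space M \<Longrightarrow> a' \<le> K ((K ^^ n) (indicator A)) x \<and> K ((K ^^ n) (indicator A)) x \<le> b'"
      "b' - a' = 7 / 8 * (b - a)"
      using oscillation_contraction[OF tv _ ab(1), of "\<lambda>x. x"] A by (metis bounded_measurable_indicator bounded_measurable_markov_pow)
    then show ?case using ab(2) by (intro exI[of _ a'] exI[of _ b']) auto
  qed
  then obtain a b where ab: "\<And>x. x \<in> space M \<Longrightarrow> a \<le> (K ^^ n) (indicator A) x \<and> (K ^^ n) (indicator A) x \<le> b"
    "b - a = (7 / 8) ^ n" by blast
  have "prob A = (\<integral>x. (K ^^ n) (indicator A) x \<partial>M)"
    using A by (simp add: integral_markov_op_pow bm_intros)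
  also have "\<dots> \<le> (\<integral>x. b \<partial>M)"
    using ab(1) by (intro integral_mono bounded_measurable_integrable bm_intros A) auto
  finally have "prob A \<le> b" by (simp add: prob_space)
  then show ?thesis using ab x by fastforce
qed

text \<open>As \<alpha> \<le> 1/2, sets of measure at least 1/2 are among those over which the
  maximum is taken, so its value \<open>H\<close> gives a \<open>hitting_bound\<close> for each of
  them. The null point \<open>x0\<close> secures \<open>1 \<le> H\<close>.\<close>

lemma mixing_time_lazy_le_max_hitting_time:
  assumes h1: "\<And>x. h x 1 = p x" and \<alpha>: "\<alpha> \<le> 1 / 2"
    and x0: "x0 \<in> space M" "{x0} \<in> sets M" "prob {x0} = 0"
  shows "ennreal (1 / 55) * ennreal_of_enat (mixing_time (lazy_kernel M h) M) \<le> max_hitting_time h M \<alpha>"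
proof (cases "max_hitting_time h M \<alpha> = top")
  case False
  define H where "H = enn2real (max_hitting_time h M \<alpha>)"
  have H_eq: "max_hitting_time h M \<alpha> = ennreal H" "0 \<le> H"
    using False by (auto simp: H_def less_top)
  have bound: "(\<Sum>n. avoid A n (\<lambda>_. 1) x) \<le> ennreal H"
    if "A \<in> sets M" "\<alpha> \<le> prob A" "x \<in> space M" for A x
  proof -
    have "(\<integral>\<^sup>+\<omega>. ennreal_of_enat (hitting_time A \<omega>) \<partial>path_law M h x) \<le> max_hitting_time h M \<alpha>"
      unfolding max_hitting_time_def using that by (intro SUP_upper2[of "(x, A)"]) auto
    then show ?thesis using expected_hitting_time[of h x A] h1 that H_eq by simp
  qed
  \<comment> \<open>The complement of \<open>x0\<close> has full measure and is not hit at time 0 by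
    the chain started at \<open>x0\<close>.\<close>
  have "1 \<le> H"
  proof -
    have "prob (space M - {x0}) = 1" using x0 by (simp add: prob_compl)
    then have "(\<Sum>n. avoid (space M - {x0}) n (\<lambda>_. 1) x0) \<le> ennreal H"
      using x0 \<alpha> by (intro bound) auto
    moreover have "avoid (space M - {x0}) 0 (\<lambda>_. 1) x0 \<le> (\<Sum>n. avoid (space M - {x0}) n (\<lambda>_. 1) x0)"
      using sum_le_suminf[of "\<lambda>n. avoid (space M - {x0}) n (\<lambda>_. 1) x0" "{0}"] by (simp del: avoid.simps)
    ultimately have "avoid (space M - {x0}) 0 (\<lambda>_. 1) x0 \<le> ennreal H" by (rule order_trans[rotated])
    then show ?thesis using x0 by simp
  qed
  have "\<exists>h. hitting_bound A H h" if "A \<in> sets M" "1 / 2 \<le> prob A" for A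
    using that \<alpha> H_eq by (intro hitting_bound_expected_hitting_time reversible_kernel_axioms bound) auto
  then obtain n :: nat where n: "real n \<le> 55 * H"
    "\<And>A x. A \<in> sets M \<Longrightarrow> x \<in> space M \<Longrightarrow> \<bar>(L ^^ n) (indicator A) x - prob A\<bar> \<le> 1 / 4"
    using lazy_mixing[OF _ \<open>1 \<le> H\<close>] by blast
  interpret lz: reversible_kernel M lazy_step by (rule reversible_kernel_lazy_step)
  interpret lzn: markov_kernel M "\<lambda>x. iterate_kernel M lazy_step x n" by (rule lz.markov_kernel_iterate)
  have lazy: "lazy_kernel M h = iterate_kernel M lazy_step"
    by (simp add: lazy_kernel_def lazy_step_def[abs_def] h1[unfolded One_nat_def])
  have "(SUP x\<in>space M. tv_dist (lazy_kernel M h x n) M) \<le> 1 / 4"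
    unfolding lazy
  proof (rule SUP_tv_dist_le_iff[THEN iffD2], goal_cases)
    case 3
    show ?case
    proof (intro ballI)
    fix x A assume "x \<in> space M" "A \<in> sets M"
    then show "\<bar>measure (iterate_kernel M lazy_step x n) A - prob A\<bar> \<le> 1 / 4"
        using n(2)[of A x] by (simp add: lz.measure_iterate markov_op_lazy_step_pow bm_intros)
    qed
  qed (auto intro: prob_space_axioms lzn.prob_space_kernel)
  then have "mixing_time (lazy_kernel M h) M \<le> enat n"
    unfolding mixing_time_def by (intro Inf_lower) auto
  then have "ennreal (1 / 55) * ennreal_of_enat (mixing_time (lazy_kernel M h) M) \<le> ennreal (1 / 55) * ennreal_of_enat (enat n)"
    by (intro mult_left_mono iffD2[OF ennreal_of_enat_le_iff]) auto
  also have "\<dots> = ennreal (real n / 55)"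
    by (simp add: ennreal_of_nat_eq_real_of_nat ennreal_mult[symmetric])
  also have "\<dots> \<le> ennreal H" using n(1) by (intro ennreal_leI) simp
  finally show ?thesis using H_eq by simp
qed simp

lemma max_hitting_time_skeleton_le:
  assumes \<alpha>: "0 < \<alpha>" "\<alpha> \<le> 1" and m: "(7 / 8) ^ m \<le> \<alpha> / 2" "0 < m"
    and x0: "x0 \<in> space M" "{x0} \<in> sets M" "prob {x0} = 0"
  shows "max_hitting_time (skeleton_kernel k (iterate_kernel M p)) M \<alpha>
    \<le> ennreal (2 * m / \<alpha>) * (1 + ennreal_of_enat (mixing_time (iterate_kernel M p) M) / of_nat k)"
proof (cases "mixing_time (iterate_kernel M p) M")
  case infinity
  have "(\<infinity>::ennreal) / of_nat k = \<infinity>"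
    by (simp add: divide_ennreal_def ennreal_top_mult)
  then show ?thesis using \<alpha> m infinity by (simp add: ennreal_mult_top)
next
  case (enat t)
  interpret T: reversible_kernel M "\<lambda>x. iterate_kernel M p x t" by (rule reversible_kernel_iterate)
  have "enat t \<in> enat ` {t. (SUP x\<in>space M. tv_dist (iterate_kernel M p x t) M) \<le> 1 / 4}"
  proof -
    let ?T = "enat ` {t. (SUP x\<in>space M. tv_dist (iterate_kernel M p x t) M) \<le> 1 / 4}"
    have "Inf ?T = enat t" using enat by (simp add: mixing_time_def)
    moreover from this have "?T \<noteq> {}" unfolding Inf_enat_def by (metis enat.distinct(1))
    ultimately show ?thesis using LeastI_ex[of "\<lambda>i. i \<in> ?T"] unfolding Inf_enat_def by (metis ex_in_conv)
  qed
  then have tv: "\<bar>measure (iterate_kernel M p x t) S - prob S\<bar> \<le> 1 / 4" if "x \<in> space M" "S \<in> sets M" for x S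
    using that SUP_tv_dist_le_iff[OF prob_space_axioms T.prob_space_kernel, of "\<lambda>x. x" "1 / 4"] by auto
  show ?thesis
  proof (cases "k = 0")
    case True
    \<comment> \<open>For \<open>k = 0\<close> the quotient is infinite once the numerator is
      positive. At time 0 the point mass at the null point \<open>x0\<close> differs from
      \<open>M\<close> by 1 on \<open>{x0}\<close>, so \<open>t = 0\<close> is impossible.\<close>
    have "t \<noteq> 0"
    proof
      assume "t = 0"
      then show False using tv[OF x0(1,2)] x0 by (simp add: measure_return)
    qed
    then have "ennreal_of_enat (enat t) / of_nat k = top"
      using True by (simp add: divide_ennreal_def ennreal_mult_top)
    then show ?thesis using \<alpha> m enat by (simp add: ennreal_mult_top)
  next
    case False
    interpret Q: reversible_kernel M "\<lambda>x. iterate_kernel M p x k" by (rule reversible_kernel_iterate)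
    \<comment> \<open>Enough skeleton steps to cover time \<open>m * t\<close>. The added 1 rounds
      up and keeps \<open>n\<close> positive; \<open>0 < m\<close> lets it be absorbed into
      \<open>m * (1 + t / k)\<close>.\<close>
    define n where "n = m * t div k + 1"
    have n: "m * t \<le> k * n" "real n \<le> m * (1 + t / k)" "0 < n"
    proof -
      show "m * t \<le> k * n" using dividend_less_times_div[of k "m * t"] False by (simp add: n_def)
      have "real (m * t div k) \<le> real (m * t) / real k" by (rule of_nat_div_le_of_nat)
      then show "real n \<le> m * (1 + t / k)" using m(2)
        by (simp only: n_def distrib_left of_nat_add of_nat_mult of_nat_1 times_divide_eq_right)
      show "0 < n" by (simp add: n_def)
    qed
    have pow_t: "((T.K ^^ j) f) x = (K ^^ (j * t)) f x" if "f \<in> bounded_measurable M" "x \<in> space M" for f x j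
      using that(2)
    proof (induction j arbitrary: x)
      case (Suc j)
      have "T.K ((T.K ^^ j) f) x = T.K ((K ^^ (j * t)) f) x"
        using T.markov_op_cong[OF Suc.IH] by (rule fun_cong)
      also have "\<dots> = (K ^^ t) ((K ^^ (j * t)) f) x"
        by (rule markov_op_iterate[OF bounded_measurable_markov_pow[OF that(1)] Suc.prems])
      finally show ?case by (simp add: funpow_add)
    qed simp
    have pow_k: "((Q.K ^^ j) f) x = (K ^^ (j * k)) f x" if "f \<in> bounded_measurable M" "x \<in> space M" for f x j
      using that(2)
    proof (induction j arbitrary: x)
      case (Suc j)
      have "Q.K ((Q.K ^^ j) f) x = Q.K ((K ^^ (j * k)) f) x"
        using Q.markov_op_cong[OF Suc.IH] by (rule fun_cong)
      also have "\<dots> = (K ^^ k) ((K ^^ (j * k)) f) x"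
        by (rule markov_op_iterate[OF bounded_measurable_markov_pow[OF that(1)] Suc.prems])
      finally show ?case by (simp add: funpow_add)
    qed simp
    have avoid_le: "Q.avoid A n (\<lambda>_. 1) x \<le> ennreal (1 - \<alpha> / 2)"
      if A: "A \<in> sets M" "\<alpha> \<le> prob A" and x: "x \<in> space M" for A x
    proof -
      interpret Qn: markov_kernel M "\<lambda>x. iterate_kernel M (\<lambda>x. iterate_kernel M p x k) x n"
        by (rule Q.markov_kernel_iterate)
      interpret Qx: prob_space "iterate_kernel M (\<lambda>x. iterate_kernel M p x k) x n"
        by (rule Qn.prob_space_kernel[OF x])
      \<comment> \<open>At time \<open>m * t\<close> the deviation (7/8)^m takes away at most half
        of \<alpha>.\<close>
      have base: "\<alpha> / 2 \<le> (K ^^ (m * t)) (indicator A) y" if "y \<in> space M" for y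
      proof -
        have "prob A - (7 / 8) ^ m \<le> (T.K ^^ m) (indicator A) y"
          using tv A(1) that by (rule T.markov_op_pow_lower)
        also have "\<dots> = (K ^^ (m * t)) (indicator A) y"
          by (rule pow_t[OF bounded_measurable_indicator[OF A(1)] that])
        finally show ?thesis using A(2) m(1) by linarith
      qed
      \<comment> \<open>\<open>K\<close> preserves constant lower bounds, so the estimate persists
        at all later times, in particular at the multiple \<open>n * k\<close> of
        \<open>k\<close>.\<close>
      have "\<alpha> / 2 \<le> (K ^^ (i + m * t)) (indicator A) y" if "y \<in> space M" for i y
        using that
      proof (induction i arbitrary: y)
        case 0
        then show ?case using base[of y] by simp
      next
        case (Suc i)
        have "K (\<lambda>_. \<alpha> / 2) y \<le> K ((K ^^ (i + m * t)) (indicator A)) y"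
          by (rule markov_op_mono[OF Suc.prems bounded_measurable_const
                bounded_measurable_markov_pow[OF bounded_measurable_indicator[OF A(1)]] Suc.IH])
        then show ?case using Suc.prems by (simp add: markov_op_const)
      qed
      from this[OF x, of "k * n - m * t"] have "\<alpha> / 2 \<le> (K ^^ (n * k)) (indicator A) x"
        unfolding le_add_diff_inverse2[OF n(1)] by (simp only: mult.commute[of n k])
      also have "\<dots> = Qx.prob A"
        unfolding Q.measure_iterate[OF A(1) x] pow_k[OF bounded_measurable_indicator[OF A(1)] x] ..
      finally have "Qx.prob (space M - A) \<le> 1 - \<alpha> / 2"
        using Qx.prob_compl[of A] A x by (simp add: Qn.sets_kernel Qn.space_kernel)
      then have "emeasure (iterate_kernel M (\<lambda>x. iterate_kernel M p x k) x n) (space M - A) \<le> ennreal (1 - \<alpha> / 2)"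
        unfolding Qx.emeasure_eq_measure by (rule ennreal_leI)
      with Q.avoid_le_iterate[OF A(1) x] show ?thesis by (rule order_trans)
    qed
    have "max_hitting_time (skeleton_kernel k (iterate_kernel M p)) M \<alpha> \<le> ennreal (n / (1 - (1 - \<alpha> / 2)))"
      unfolding max_hitting_time_def
    proof (rule SUP_least, clarify)
      fix x A assume x: "x \<in> space M" and A: "A \<in> sets M" "\<alpha> \<le> prob A"
      have "(\<integral>\<^sup>+\<omega>. ennreal_of_enat (hitting_time A \<omega>) \<partial>path_law M (skeleton_kernel k (iterate_kernel M p)) x)
        = (\<Sum>i. Q.avoid A i (\<lambda>_. 1) x)"
        using x A by (intro Q.expected_hitting_time) (auto simp: skeleton_kernel_def)
      also have "\<dots> \<le> ennreal (n / (1 - (1 - \<alpha> / 2)))"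
        using A x \<alpha> n by (intro Q.suminf_avoid_le avoid_le) auto
      finally show "(\<integral>\<^sup>+\<omega>. ennreal_of_enat (hitting_time A \<omega>) \<partial>path_law M (skeleton_kernel k (iterate_kernel M p)) x)
        \<le> ennreal (n / (1 - (1 - \<alpha> / 2)))" .
    qed
    also have "\<dots> \<le> ennreal (2 * m / \<alpha> * (1 + t / k))"
    proof (rule ennreal_leI)
      have "n / (1 - (1 - \<alpha> / 2)) = 2 / \<alpha> * real n" by simp
      also have "\<dots> \<le> 2 / \<alpha> * (m * (1 + t / k))" using n(2) \<alpha> by (intro mult_left_mono) auto
      finally show "n / (1 - (1 - \<alpha> / 2)) \<le> 2 * m / \<alpha> * (1 + t / k)" by simp
    qed
    also have "ennreal (2 * m / \<alpha> * (1 + t / k)) =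
      ennreal (2 * m / \<alpha>) * (1 + ennreal_of_enat (enat t) / of_nat k)"
    proof -
      have "ennreal (1 + t / k) = 1 + of_nat t / of_nat k"
        using False by (simp add: ennreal_plus divide_ennreal[symmetric] ennreal_of_nat_eq_real_of_nat)
      then show ?thesis using \<alpha> by (subst ennreal_mult) auto
    qed
    finally show ?thesis unfolding enat by simp
  qed
qed

end

section \<open>The Gibbs kernel\<close>

lemma (in real_distribution) inv_cdf_le_iff:
  assumes cont: "\<And>x. isCont (cdf M) x" and mono: "strict_mono (cdf M)" and u: "0 < u" "u < 1"
  shows "inv (cdf M) u \<le> z \<longleftrightarrow> u \<le> cdf M z"
proof -
  obtain a where a: "cdf M a < u"
    using order_tendstoD(2)[OF cdf_lim_at_bot u(1)] eventually_happens'[OF trivial_limit_at_bot_linorder] by blast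
  obtain b where b: "u < cdf M b"
    using order_tendstoD(1)[OF cdf_lim_at_top_prob u(2)] eventually_happens'[OF trivial_limit_at_top_linorder] by blast
  have "a \<le> b" using a b strict_mono_less_eq[OF mono, of a b] by linarith
  then obtain x where "cdf M x = u" using IVT[of "cdf M" a u b] a b cont by auto
  then have "cdf M (inv (cdf M) u) = u" by (metis f_inv_into_f rangeI)
  then show ?thesis using strict_mono_less_eq[OF mono, of "inv (cdf M) u" z] by simp
qed

text \<open>Outside of the open unit interval \<open>inv\<close> returns one and the same arbitrary value.\<close>

lemma (in real_distribution) inv_cdf:
  assumes cont: "\<And>x. isCont (cdf M) x" and mono: "strict_mono (cdf M)"
  shows measurable_inv_cdf: "inv (cdf M) \<in> borel_measurable borel"
    and distr_inv_cdf: "distr (uniform_measure lborel {0..1}) borel (inv (cdf M)) = M"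
proof -
  have range: "0 < cdf M x" "cdf M x < 1" for x
    using strict_monoD[OF mono, of "x - 1" x] strict_monoD[OF mono, of x "x + 1"]
      cdf_nonneg[of "x - 1"] cdf_bounded_prob[of "x + 1"] by linarith+
  have outside: "inv (cdf M) u = inv (cdf M) 2" if "\<not> (0 < u \<and> u < 1)" for u
  proof -
    have "cdf M x \<noteq> u" "cdf M x \<noteq> 2" for x using range[of x] that by auto
    then show ?thesis by (simp add: inv_into_def)
  qed
  have meas: "{u. inv (cdf M) u \<le> z} \<in> sets borel" for z
  proof -
    have "{u. inv (cdf M) u \<le> z} = {0<..<1} \<inter> {..cdf M z} \<union> (if inv (cdf M) 2 \<le> z then - {0<..<1} else {})"
    proof (rule set_eqI)
      fix u
      show "u \<in> {u. inv (cdf M) u \<le> z} \<longleftrightarrow>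
        u \<in> {0<..<1} \<inter> {..cdf M z} \<union> (if inv (cdf M) 2 \<le> z then - {0<..<1} else {})"
        using inv_cdf_le_iff[OF assms, of u z] outside[of u] by (cases "0 < u \<and> u < 1") auto
    qed
    then show ?thesis by auto
  qed
  show M [measurable]: "inv (cdf M) \<in> borel_measurable borel"
    using meas by (simp add: borel_measurable_iff_le)
  interpret U: prob_space "uniform_measure lborel {0..1::real}" by (rule prob_space_uniform_measure) auto
  show "distr (uniform_measure lborel {0..1}) borel (inv (cdf M)) = M"
  proof (rule cdf_unique)
    show "real_distribution (distr (uniform_measure lborel {0..1}) borel (inv (cdf M)))"
      by (rule U.real_distribution_distr) simp
    show "real_distribution M" ..
    show "cdf (distr (uniform_measure lborel {0..1}) borel (inv (cdf M))) = cdf M"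
    proof
      fix z
      have "cdf (distr (uniform_measure lborel {0..1}) borel (inv (cdf M))) z =
        measure (uniform_measure lborel {0..1}) {u. inv (cdf M) u \<le> z}"
        unfolding cdf_def[of "distr _ _ _"] by (subst measure_distr) (auto simp: vimage_def)
      also have "\<dots> = measure lborel ({0..1} \<inter> {u. inv (cdf M) u \<le> z})"
        using meas by (subst measure_uniform_measure) auto
      \<comment> \<open>The two sets can differ only at the endpoints 0 and 1, where
        \<open>inv\<close> is arbitrary.\<close>
      also have "emeasure lborel ({0..1} \<inter> {u. inv (cdf M) u \<le> z}) = emeasure lborel {0<..cdf M z}"
      proof (rule emeasure_eq_AE)
        show "AE u in lborel. u \<in> {0..1} \<inter> {u. inv (cdf M) u \<le> z} \<longleftrightarrow> u \<in> {0<..cdf M z}"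
          using AE_lborel_singleton[of 0] AE_lborel_singleton[of 1]
        proof eventually_elim
          case (elim u)
          then show ?case using inv_cdf_le_iff[OF assms, of u z] range[of z]
            by (cases "0 < u \<and> u < 1") auto
        qed
      qed (use meas in auto)
      then have "measure lborel ({0..1} \<inter> {u. inv (cdf M) u \<le> z}) = cdf M z"
        using range(1)[of z] by (simp add: measure_def)
      finally show "cdf (distr (uniform_measure lborel {0..1}) borel (inv (cdf M))) z = cdf M z" .
    qed
  qed
qed

section \<open>Conditional densities of the target\<close>

locale gibbs =
  fixes d :: nat and \<rho> :: "(nat \<Rightarrow> real) \<Rightarrow> real"
  assumes gibbs_density: "gibbs_density d \<rho>"
begin

abbreviation "N \<equiv> lebesgue_Rn d"
abbreviation "\<pi> \<equiv> target d \<rho>"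

lemma space_N: "space N = {1..d} \<rightarrow>\<^sub>E UNIV"
  by (simp add: lebesgue_Rn_def space_PiM)

lemma d: "1 \<le> d" and cont: "continuous_on (space N) \<rho>"
  and pos: "x \<in> space N \<Longrightarrow> 0 < \<rho> x" and prob_\<pi>: "prob_space \<pi>"
  and int: "x \<in> space N \<Longrightarrow> i \<in> {1..d} \<Longrightarrow> integrable lborel (\<lambda>y. \<rho> (x(i := y)))"
  using gibbs_density unfolding gibbs_density_def by auto

lemma sets_\<pi> [measurable_cong]: "sets \<pi> = sets N" and space_\<pi>: "space \<pi> = space N"
  by (simp_all add: target_def)

lemma upd_space: "x \<in> space N \<Longrightarrow> i \<in> {1..d} \<Longrightarrow> x(i := z) \<in> space N"
  by (auto simp: space_N PiE_iff extensional_def)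

text \<open>Continuity refers to all of \<open>nat \<Rightarrow> real\<close>, the sigma-algebra to
  the coordinates 1 to \<open>d\<close>. The inclusion is measurable because the remaining
  coordinates are constantly \<open>undefined\<close>, and on a countable product of reals the Borel
  and product sigma-algebras agree.\<close>

lemma measurable_\<rho> [measurable]: "\<rho> \<in> borel_measurable N"
proof -
  have "(\<lambda>x. x) \<in> N \<rightarrow>\<^sub>M (\<Pi>\<^sub>M i\<in>(UNIV :: nat set). (borel :: real measure))"
  proof (rule measurable_PiM_single')
    fix i :: nat
    show "(\<lambda>x. x i) \<in> N \<rightarrow>\<^sub>M (borel :: real measure)"
    proof (cases "i \<in> {1..d}")
      case True
      then show ?thesis using measurable_component_singleton[OF True, of "\<lambda>_. lborel :: real measure"]
        by (simp add: lebesgue_Rn_def)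
    next
      case False
      then have "x i = undefined" if "x \<in> space N" for x using that by (auto simp: space_N PiE_iff extensional_def)
      then show ?thesis by (subst measurable_cong[of _ _ "\<lambda>_. undefined"]) auto
    qed
  qed auto
  then have "(\<lambda>x. x) \<in> N \<rightarrow>\<^sub>M borel"
    using measurable_cong_sets[OF refl sets_PiM_equal_borel] by blast
  then have "(\<lambda>x. x) \<in> N \<rightarrow>\<^sub>M restrict_space borel (space N)" by (intro measurable_restrict_space2) auto
  from measurable_compose[OF this borel_measurable_continuous_on_restrict[OF cont]] show ?thesis .
qed

lemma measurable_upd [measurable]:
  assumes "i \<in> {1..d}"
  shows "(\<lambda>(x, z). x(i := z)) \<in> N \<Otimes>\<^sub>M lborel \<rightarrow>\<^sub>M N"
proof -
  have "insert i {1..d} = {1..d}" using assms by auto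
  then show ?thesis using measurable_add_dim[of i "{1..d}" "\<lambda>_. lborel :: real measure"]
    by (simp add: lebesgue_Rn_def)
qed

lemma measurable_upd1: 
  assumes "i \<in> {1..d}" "x \<in> space N"
  shows "(\<lambda>z. x(i := z)) \<in> borel \<rightarrow>\<^sub>M N"
proof -
  have "(\<lambda>z. (x, z)) \<in> borel \<rightarrow>\<^sub>M N \<Otimes>\<^sub>M lborel" using assms by (intro measurable_Pair) auto
  from measurable_compose[OF this measurable_upd[OF assms(1)]] show ?thesis by simp
qed

text \<open>The normalizing constant does not depend on the \<open>i\<close>-th coordinate of
  \<open>x\<close>; detailed balance rests on this.\<close>

definition Z :: "nat \<Rightarrow> (nat \<Rightarrow> real) \<Rightarrow> real" where
  "Z i x = (\<integral>y. \<rho> (x(i := y)) \<partial>lborel)"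

lemma ennreal_Z:
  assumes "x \<in> space N" "i \<in> {1..d}"
  shows "ennreal (Z i x) = (\<integral>\<^sup>+y. ennreal (\<rho> (x(i := y))) \<partial>lborel)"
  unfolding Z_def using assms upd_space pos
  by (intro nn_integral_eq_integral[symmetric] int) (auto intro!: AE_I2 less_imp_le)

lemma measurable_\<rho>_upd [measurable]:
  "i \<in> {1..d} \<Longrightarrow> x \<in> space N \<Longrightarrow> (\<lambda>z. \<rho> (x(i := z))) \<in> borel_measurable borel"
  by (rule measurable_compose[OF measurable_upd1 measurable_\<rho>])

lemma Z_pos:
  assumes "x \<in> space N" "i \<in> {1..d}"
  shows "0 < Z i x"
proof -
  have "(\<integral>\<^sup>+y. ennreal (\<rho> (x(i := y))) \<partial>lborel) \<noteq> 0"
  proof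
    assume "(\<integral>\<^sup>+y. ennreal (\<rho> (x(i := y))) \<partial>lborel) = 0"
    then have "AE y in lborel. ennreal (\<rho> (x(i := y))) = 0"
      using assms by (subst (asm) nn_integral_0_iff_AE) auto
    moreover have "ennreal (\<rho> (x(i := y))) \<noteq> 0" for y
      using pos[OF upd_space[OF assms, of y]] by simp
    ultimately have "AE y in (lborel :: real measure). False" by simp
    then show False by (subst (asm) AE_iff_measurable[of UNIV]) auto
  qed
  then show ?thesis unfolding ennreal_Z[OF assms, symmetric] by (simp add: ennreal_eq_0_iff not_le)
qed

lemma cond_density_eq: "cond_density \<rho> x i z = \<rho> (x(i := z)) / Z i x"
  by (simp add: cond_density_def Z_def)

lemma cond_density_pos: "x \<in> space N \<Longrightarrow> i \<in> {1..d} \<Longrightarrow> 0 < cond_density \<rho> x i z"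
  by (simp add: cond_density_eq Z_pos pos upd_space)

lemma measurable_cond_density [measurable]:
  "i \<in> {1..d} \<Longrightarrow> x \<in> space N \<Longrightarrow> cond_density \<rho> x i \<in> borel_measurable borel"
  unfolding cond_density_eq[abs_def] by measurable

definition \<nu> :: "(nat \<Rightarrow> real) \<Rightarrow> nat \<Rightarrow> real measure" where
  "\<nu> x i = density lborel (\<lambda>z. ennreal (cond_density \<rho> x i z))"

context
  fixes x i assumes x: "x \<in> space N" and i: "i \<in> {1..d}"
begin

lemma measurable_ennreal_cond_density: "(\<lambda>z. ennreal (cond_density \<rho> x i z)) \<in> borel_measurable lborel"
  using measurable_cond_density[OF i x] by simp

lemma real_distribution_\<nu>: "real_distribution (\<nu> x i)"
proof -
  have "emeasure (\<nu> x i) UNIV = (\<integral>\<^sup>+z. ennreal (\<rho> (x(i := z))) / ennreal (Z i x) \<partial>lborel)"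
    unfolding \<nu>_def using measurable_ennreal_cond_density Z_pos[OF x i] pos[OF upd_space[OF x i]]
    by (subst emeasure_density) (auto intro!: nn_integral_cong simp: cond_density_eq divide_ennreal less_imp_le)
  also have "\<dots> = 1"
    using i x Z_pos[OF x i] by (simp add: nn_integral_divide ennreal_Z[symmetric])
  finally have "prob_space (\<nu> x i)" by (intro prob_spaceI) (simp add: \<nu>_def)
  then show ?thesis by (simp add: real_distribution_def real_distribution_axioms_def \<nu>_def)
qed

lemma strict_mono_cdf_\<nu>: "strict_mono (cdf (\<nu> x i))"
proof (rule strict_monoI)
  interpret real_distribution "\<nu> x i" by (rule real_distribution_\<nu>)
  fix a b :: real assume ab: "a < b"
  have "emeasure (\<nu> x i) {a<..b} \<noteq> 0"
  proof
    assume "emeasure (\<nu> x i) {a<..b} = 0"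
    then have "AE z in lborel. ennreal (cond_density \<rho> x i z) * indicator {a<..b} z = 0"
      unfolding \<nu>_def using measurable_ennreal_cond_density
      by (subst (asm) emeasure_density) (auto simp: nn_integral_0_iff_AE)
    moreover have "ennreal (cond_density \<rho> x i z) \<noteq> 0" for z
      using cond_density_pos[OF x i, of z] by simp
    ultimately have "AE z in lborel. z \<notin> {a<..b}"
      by (auto simp: indicator_def elim: eventually_mono split: if_splits)
    then have "emeasure lborel {a<..b} = 0" by (subst (asm) AE_iff_measurable[of "{a<..b}"]) auto
    then show False using ab by simp
  qed
  then have "0 < measure (\<nu> x i) {a<..b}" by (simp add: emeasure_eq_measure zero_less_measure_iff)
  then show "cdf (\<nu> x i) a < cdf (\<nu> x i) b" using cdf_diff_eq[OF ab] by simp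
qed

lemma isCont_cdf_\<nu>: "isCont (cdf (\<nu> x i)) z"
proof -
  interpret real_distribution "\<nu> x i" by (rule real_distribution_\<nu>)
  have "emeasure (\<nu> x i) {z} = 0"
    unfolding \<nu>_def using measurable_ennreal_cond_density by (subst emeasure_density) (auto simp: nn_integral_indicator_singleton)
  then show ?thesis by (simp add: isCont_cdf measure_def)
qed

lemma cond_cdf_eq: "cond_cdf \<rho> x i = cdf (\<nu> x i)"
  by (simp add: cond_cdf_def \<nu>_def)

lemma measurable_inv_cond_cdf: "inv (cond_cdf \<rho> x i) \<in> borel_measurable borel"
  and distr_inv_cond_cdf: "distr (uniform_measure lborel {0..1}) borel (inv (cond_cdf \<rho> x i)) = \<nu> x i"
proof -
  interpret real_distribution "\<nu> x i" by (rule real_distribution_\<nu>)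
  show "inv (cond_cdf \<rho> x i) \<in> borel_measurable borel"
    "distr (uniform_measure lborel {0..1}) borel (inv (cond_cdf \<rho> x i)) = \<nu> x i"
    unfolding cond_cdf_eq
    by (rule measurable_inv_cdf distr_inv_cdf; rule isCont_cdf_\<nu> strict_mono_cdf_\<nu>)+
qed

end

section \<open>One step of the sampler and its detailed balance\<close>

definition step :: "(nat \<Rightarrow> real) \<Rightarrow> (nat \<Rightarrow> nat) \<times> (nat \<Rightarrow> real) \<Rightarrow> nat \<Rightarrow> real" where
  "step x = (\<lambda>(I, U). x(I 0 := inv (cond_cdf \<rho> x (I 0)) (U 0)))"

lemma gibbs_kernel_1: "gibbs_kernel d \<rho> x 1 = distr (gibbs_noise d) N (step x)"
  by (simp add: gibbs_kernel_def step_def)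

lemma prob_space_index: "prob_space (uniform_count_measure {1..d})"
  using d by (intro prob_space_uniform_count_measure) auto

lemma prob_space_uniform: "prob_space (uniform_measure lborel {0..1::real})"
  by (rule prob_space_uniform_measure) auto

text \<open>The index takes finitely many values, so the map is glued from one measurable map per
  index. Here \<open>x\<close> is fixed; dependence on \<open>x\<close> is treated through
  integrals.\<close>

lemma measurable_step:
  assumes x: "x \<in> space N"
  shows "step x \<in> gibbs_noise d \<rightarrow>\<^sub>M N"
proof -
  let ?PI = "\<Pi>\<^sub>M t\<in>(UNIV :: nat set). uniform_count_measure {1..d}"
  let ?PU = "\<Pi>\<^sub>M t\<in>(UNIV :: nat set). uniform_measure lborel {0..1::real}"
  have U0: "(\<lambda>\<omega>. snd \<omega> 0) \<in> ?PI \<Otimes>\<^sub>M ?PU \<rightarrow>\<^sub>M (borel :: real measure)"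
    using measurable_compose[OF measurable_snd measurable_component_singleton[of 0 UNIV "\<lambda>_. uniform_measure lborel {0..1::real}"]]
    by simp
  have I0: "(\<lambda>\<omega>. fst \<omega> 0) \<in> ?PI \<Otimes>\<^sub>M ?PU \<rightarrow>\<^sub>M count_space {1..d}"
    using measurable_compose[OF measurable_fst measurable_component_singleton[of 0 UNIV "\<lambda>_. uniform_count_measure {1..d}"]]
      measurable_cong_sets[OF refl sets_uniform_count_measure_count_space] by auto
  have "(\<lambda>\<omega>. x(i := inv (cond_cdf \<rho> x i) (snd \<omega> 0))) \<in> ?PI \<Otimes>\<^sub>M ?PU \<rightarrow>\<^sub>M N" if "i \<in> {1..d}" for i
    by (rule measurable_compose[OF measurable_compose[OF U0 measurable_inv_cond_cdf[OF x that]] measurable_upd1[OF that x]])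
  from measurable_compose_countable'[OF this I0]
  show ?thesis by (simp add: gibbs_noise_def step_def split_beta')
qed

text \<open>One step uses only the time-0 marginals of the two noise sequences, and inverse
  transform sampling turns the uniform variable into a draw from the conditional density. From here
  on the kernel is handled without \<open>inv\<close>.\<close>

lemma nn_integral_gibbs_kernel:
  assumes x: "x \<in> space N" and f [measurable]: "f \<in> borel_measurable N"
  shows "(\<integral>\<^sup>+y. f y \<partial>gibbs_kernel d \<rho> x 1) =
    (\<Sum>i\<in>{1..d}. ennreal (1 / d) * (\<integral>\<^sup>+z. ennreal (cond_density \<rho> x i z) * f (x(i := z)) \<partial>lborel))"
proof -
  let ?I = "\<lambda>_::nat. uniform_count_measure {1..d}" and ?U = "\<lambda>_::nat. uniform_measure lborel {0..1::real}"
  let ?PI = "PiM UNIV ?I" and ?PU = "PiM UNIV ?U"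
  interpret PU: prob_space ?PU by (intro prob_space_PiM prob_space_uniform)
  have "(\<integral>\<^sup>+y. f y \<partial>gibbs_kernel d \<rho> x 1) = (\<integral>\<^sup>+\<omega>. f (step x \<omega>) \<partial>gibbs_noise d)"
    unfolding gibbs_kernel_1 by (intro nn_integral_distr measurable_step x) simp
  also have "\<dots> = (\<integral>\<^sup>+I. \<integral>\<^sup>+U. f (step x (I, U)) \<partial>?PU \<partial>?PI)"
    using measurable_compose[OF measurable_step[OF x] f] unfolding gibbs_noise_def
    by (intro PU.nn_integral_fst[symmetric]) simp
  also have "\<dots> = (\<integral>\<^sup>+I. (\<integral>\<^sup>+z. f (x(I 0 := z)) \<partial>\<nu> x (I 0)) \<partial>?PI)"
  proof (rule nn_integral_cong)
    fix I assume "I \<in> space ?PI"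
    then have i: "I 0 \<in> {1..d}" by (auto simp: space_PiM space_uniform_count_measure)
    note [measurable] = measurable_inv_cond_cdf[OF x i] measurable_upd1[OF i x]
    have fx [measurable]: "(\<lambda>z. f (x(I 0 := z))) \<in> borel_measurable borel"
      by (rule measurable_compose[OF measurable_upd1[OF i x] f])
    have "(\<integral>\<^sup>+U. f (step x (I, U)) \<partial>?PU) = (\<integral>\<^sup>+u. f (x(I 0 := inv (cond_cdf \<rho> x (I 0)) u)) \<partial>distr ?PU (?U 0) (\<lambda>U. U 0))"
      unfolding step_def by (subst nn_integral_distr) simp_all
    also have "distr ?PU (?U 0) (\<lambda>U. U 0) = ?U 0"
      by (rule distr_PiM_component) (auto intro: prob_space_uniform)
    also have "(\<integral>\<^sup>+u. f (x(I 0 := inv (cond_cdf \<rho> x (I 0)) u)) \<partial>?U 0) = (\<integral>\<^sup>+z. f (x(I 0 := z)) \<partial>\<nu> x (I 0))"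
      unfolding distr_inv_cond_cdf[OF x i, symmetric]
      by (subst nn_integral_distr) simp_all
    finally show "(\<integral>\<^sup>+U. f (step x (I, U)) \<partial>?PU) = (\<integral>\<^sup>+z. f (x(I 0 := z)) \<partial>\<nu> x (I 0))" .
  qed
  also have "\<dots> = (\<integral>\<^sup>+i. (\<integral>\<^sup>+z. f (x(i := z)) \<partial>\<nu> x i) \<partial>distr ?PI (?I 0) (\<lambda>I. I 0))"
    by (subst nn_integral_distr) (simp_all add: measurable_cong_sets[OF sets_uniform_count_measure_count_space refl])
  also have "distr ?PI (?I 0) (\<lambda>I. I 0) = ?I 0"
    by (rule distr_PiM_component) (rule prob_space_index, simp)
  also have "(\<integral>\<^sup>+i. (\<integral>\<^sup>+z. f (x(i := z)) \<partial>\<nu> x i) \<partial>?I 0) =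
    (\<Sum>i\<in>{1..d}. ennreal (1 / d) * (\<integral>\<^sup>+z. f (x(i := z)) \<partial>\<nu> x i))"
    unfolding uniform_count_measure_def by (subst nn_integral_point_measure_finite) auto
  also have "\<dots> = (\<Sum>i\<in>{1..d}. ennreal (1 / d) * (\<integral>\<^sup>+z. ennreal (cond_density \<rho> x i z) * f (x(i := z)) \<partial>lborel))"
    unfolding \<nu>_def using x
    by (intro sum.cong refl arg_cong2[where f = times] nn_integral_density measurable_ennreal_cond_density)
       (auto intro!: measurable_compose[OF measurable_upd1 f])
  finally show ?thesis .
qed

lemma measurable_nn_integral_cond_density:
  assumes i: "i \<in> {1..d}" and g: "g \<in> borel_measurable N"
  shows "(\<lambda>x. \<integral>\<^sup>+z. ennreal (cond_density \<rho> x i z) * g (x(i := z)) \<partial>lborel) \<in> borel_measurable N"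
proof -
  have upd: "(\<lambda>w. (fst w)(i := snd w)) \<in> N \<Otimes>\<^sub>M lborel \<rightarrow>\<^sub>M N"
    using measurable_upd[OF i] by (simp add: split_beta')
  have \<rho>i: "(\<lambda>w. \<rho> ((fst w)(i := snd w))) \<in> borel_measurable (N \<Otimes>\<^sub>M lborel)"
    by (rule measurable_compose[OF upd measurable_\<rho>])
  have gi: "(\<lambda>w. g ((fst w)(i := snd w))) \<in> borel_measurable (N \<Otimes>\<^sub>M lborel)"
    by (rule measurable_compose[OF upd g])
  have "Z i \<in> borel_measurable N"
    unfolding Z_def[abs_def]
    by (rule lborel.borel_measurable_lebesgue_integral) (use \<rho>i in \<open>simp add: split_beta'\<close>)
  then have Zi: "(\<lambda>w. Z i (fst w)) \<in> borel_measurable (N \<Otimes>\<^sub>M lborel)"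
    by (rule measurable_compose[OF measurable_fst])
  have "(\<lambda>w. ennreal (\<rho> ((fst w)(i := snd w)) / Z i (fst w)) * g ((fst w)(i := snd w))) \<in> borel_measurable (N \<Otimes>\<^sub>M lborel)"
    using \<rho>i gi Zi by (intro borel_measurable_times_ennreal measurable_compose[OF _ measurable_ennreal] borel_measurable_divide)
  then show ?thesis
    unfolding cond_density_eq
    by (intro lborel.borel_measurable_nn_integral) (simp add: split_beta')
qed

text \<open>Measurability in \<open>x\<close> is read off the density formula, which avoids joint
  measurability of the inverse distribution functions in \<open>x\<close> and
  \<open>u\<close>.\<close>

lemma measurable_gibbs_kernel: "(\<lambda>x. gibbs_kernel d \<rho> x 1) \<in> \<pi> \<rightarrow>\<^sub>M prob_algebra \<pi>"
proof (rule measurable_prob_algebra_generated[OF sets.sigma_sets_eq[symmetric] sets.Int_stable sets.space_closed])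
  fix x assume x: "x \<in> space \<pi>"
  show "sets (gibbs_kernel d \<rho> x 1) = sets \<pi>" unfolding gibbs_kernel_1 by (simp add: sets_\<pi>)
  have "prob_space (gibbs_noise d)"
    unfolding gibbs_noise_def
    by (intro prob_space_pair prob_space_PiM prob_space_index prob_space_uniform)
  then show "prob_space (gibbs_kernel d \<rho> x 1)"
    using x unfolding gibbs_kernel_1 space_\<pi> by (intro prob_space.prob_space_distr measurable_step)
next
  fix A assume "A \<in> sets \<pi>"
  then have A [measurable]: "A \<in> sets N" by (simp add: sets_\<pi>)
  have "(\<lambda>x. \<Sum>i\<in>{1..d}. ennreal (1 / d) * (\<integral>\<^sup>+z. ennreal (cond_density \<rho> x i z) * indicator A (x(i := z)) \<partial>lborel)) \<in> borel_measurable N"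
  proof (intro borel_measurable_sum borel_measurable_times_ennreal borel_measurable_const)
    fix i assume i: "i \<in> {1..d}"
    show "(\<lambda>x. \<integral>\<^sup>+z. ennreal (cond_density \<rho> x i z) * indicator A (x(i := z)) \<partial>lborel) \<in> borel_measurable N"
      by (rule measurable_nn_integral_cond_density[OF i]) simp
  qed
  moreover have "emeasure (gibbs_kernel d \<rho> x 1) A =
    (\<Sum>i\<in>{1..d}. ennreal (1 / d) * (\<integral>\<^sup>+z. ennreal (cond_density \<rho> x i z) * indicator A (x(i := z)) \<partial>lborel))"
    if "x \<in> space \<pi>" for x
  proof -
    have "A \<in> sets (gibbs_kernel d \<rho> x 1)" unfolding gibbs_kernel_1 by simp
    then show ?thesis
      using nn_integral_gibbs_kernel[of x "indicator A"] that
      by (simp only: nn_integral_indicator space_\<pi> borel_measurable_indicator A)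
  qed
  ultimately show "(\<lambda>x. emeasure (gibbs_kernel d \<rho> x 1) A) \<in> borel_measurable \<pi>"
    by (subst measurable_cong) (auto simp: measurable_cong_sets[OF sets_\<pi> refl])
qed

lemma nn_integral_N:
  assumes i: "i \<in> {1..d}" and f: "f \<in> borel_measurable N"
  shows "(\<integral>\<^sup>+x. f x \<partial>N) = (\<integral>\<^sup>+w. \<integral>\<^sup>+y. f (w(i := y)) \<partial>lborel \<partial>(\<Pi>\<^sub>M j\<in>{1..d} - {i}. lborel))"
proof -
  interpret product_sigma_finite "\<lambda>_::nat. lborel :: real measure" by standard
  have "{1..d} = insert i ({1..d} - {i})" using i by auto
  then show ?thesis
    using product_nn_integral_insert[of "{1..d} - {i}" i f] f by (simp add: lebesgue_Rn_def insert_absorb)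
qed

text \<open>Every single-coordinate update is reversible: with the other coordinates
  \<open>w\<close> fixed, the flow from \<open>y\<close> to \<open>z\<close> has density \<rho>(w,y)
  \<rho>(w,z) / Z, symmetric in \<open>y\<close> and \<open>z\<close>. The random scan averages
  these updates.\<close>

lemma reversible_gibbs_kernel: "reversible_kernel \<pi> (\<lambda>x. gibbs_kernel d \<rho> x 1)"
proof -
  interpret prob_space \<pi> by (rule prob_\<pi>)
  interpret markov_kernel \<pi> "\<lambda>x. gibbs_kernel d \<rho> x 1"
    by unfold_locales (rule measurable_gibbs_kernel)
  \<comment> \<open>The point \<open>w\<close> has no \<open>i\<close>-th coordinate; the 0 is a
    placeholder that does not affect \<open>Z i\<close>.\<close>
  define E where "E i f g = (\<integral>\<^sup>+w. (\<integral>\<^sup>+y. ennreal (\<rho> (w(i := y))) * f (w(i := y)) \<partial>lborel) *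
    (\<integral>\<^sup>+z. ennreal (\<rho> (w(i := z))) * g (w(i := z)) \<partial>lborel) / ennreal (Z i (w(i := 0)))
    \<partial>(\<Pi>\<^sub>M j\<in>{1..d} - {i}. lborel))" for i and f g :: "(nat \<Rightarrow> real) \<Rightarrow> ennreal"
  have E: "(\<integral>\<^sup>+x. f x * (\<integral>\<^sup>+y. g y \<partial>gibbs_kernel d \<rho> x 1) \<partial>\<pi>) = (\<Sum>i\<in>{1..d}. ennreal (1 / d) * E i f g)"
    if "f \<in> borel_measurable \<pi>" "g \<in> borel_measurable \<pi>" for f g
  proof -
    have f [measurable]: "f \<in> borel_measurable N" and g [measurable]: "g \<in> borel_measurable N"
      using that by (simp_all add: measurable_cong_sets[OF sets_\<pi> refl])
    define k where "k i x = (\<integral>\<^sup>+z. ennreal (cond_density \<rho> x i z) * g (x(i := z)) \<partial>lborel)" for i x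
    have k [measurable]: "k i \<in> borel_measurable N" if "i \<in> {1..d}" for i
      unfolding k_def[abs_def] by (rule measurable_nn_integral_cond_density[OF that g])
    have "(\<integral>\<^sup>+x. f x * (\<integral>\<^sup>+y. g y \<partial>gibbs_kernel d \<rho> x 1) \<partial>\<pi>) =
      (\<integral>\<^sup>+x. ennreal (\<rho> x) * (f x * (\<integral>\<^sup>+y. g y \<partial>gibbs_kernel d \<rho> x 1)) \<partial>N)"
      using measurable_nn_integral_kernel[OF that(2)] unfolding target_def
      by (intro nn_integral_density) (auto simp: measurable_cong_sets[OF sets_\<pi> refl])
    also have "\<dots> = (\<integral>\<^sup>+x. (\<Sum>i\<in>{1..d}. ennreal (1 / d) * (ennreal (\<rho> x) * f x * k i x)) \<partial>N)"
      by (intro nn_integral_cong) (simp only: nn_integral_gibbs_kernel[OF _ g] k_def sum_distrib_left mult_ac)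
    also have "\<dots> = (\<Sum>i\<in>{1..d}. ennreal (1 / d) * (\<integral>\<^sup>+x. ennreal (\<rho> x) * f x * k i x \<partial>N))"
      by (subst nn_integral_sum) (auto intro!: sum.cong nn_integral_cmult)
    also have "\<dots> = (\<Sum>i\<in>{1..d}. ennreal (1 / d) * E i f g)"
    proof (intro sum.cong refl arg_cong2[where f = times])
      fix i assume i: "i \<in> {1..d}"
      show "(\<integral>\<^sup>+x. ennreal (\<rho> x) * f x * k i x \<partial>N) = E i f g"
        unfolding E_def
      proof (subst nn_integral_N[OF i], (use i in measurable)[1], rule nn_integral_cong)
        fix w assume "w \<in> space (\<Pi>\<^sub>M j\<in>{1..d} - {i}. (lborel :: real measure))"
        then have w: "w(i := y) \<in> space N" for y
          using i by (auto simp: space_N space_PiM PiE_iff extensional_def)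
        have Zw: "Z i (w(i := y)) = Z i (w(i := 0))" for y by (simp add: Z_def)
        have Zw0: "0 < Z i (w(i := 0))" using Z_pos[OF w i] .
        have m: "(\<lambda>y. ennreal (\<rho> (w(i := y))) * h (w(i := y))) \<in> borel_measurable lborel"
          if "h \<in> borel_measurable N" for h :: "_ \<Rightarrow> ennreal"
          using measurable_compose[OF measurable_upd1[OF i w[of 0]] that]
            measurable_compose[OF measurable_upd1[OF i w[of 0]] measurable_\<rho>] by simp
        have "k i (w(i := y)) = (\<integral>\<^sup>+z. ennreal (\<rho> (w(i := z))) * g (w(i := z)) / ennreal (Z i (w(i := 0))) \<partial>lborel)" for y
          unfolding k_def
        proof (rule nn_integral_cong)
          fix z
          have "ennreal (cond_density \<rho> (w(i := y)) i z) = ennreal (\<rho> (w(i := z))) / ennreal (Z i (w(i := 0)))"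
            unfolding cond_density_eq Zw[of y] fun_upd_upd by (rule divide_ennreal[symmetric]) (use pos[OF w] Zw0 in \<open>auto intro: less_imp_le\<close>)
          then show "ennreal (cond_density \<rho> (w(i := y)) i z) * g (w(i := y, i := z)) =
            ennreal (\<rho> (w(i := z))) * g (w(i := z)) / ennreal (Z i (w(i := 0)))"
            by (simp only: fun_upd_upd divide_ennreal_def mult_ac)
        qed
        also have "\<dots> = (\<integral>\<^sup>+z. ennreal (\<rho> (w(i := z))) * g (w(i := z)) \<partial>lborel) / ennreal (Z i (w(i := 0)))"
          by (intro nn_integral_divide m g)
        finally have "(\<integral>\<^sup>+y. ennreal (\<rho> (w(i := y))) * f (w(i := y)) * k i (w(i := y)) \<partial>lborel) =
          (\<integral>\<^sup>+y. ennreal (\<rho> (w(i := y))) * f (w(i := y)) *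
            ((\<integral>\<^sup>+z. ennreal (\<rho> (w(i := z))) * g (w(i := z)) \<partial>lborel) / ennreal (Z i (w(i := 0)))) \<partial>lborel)"
          by simp
        also have "\<dots> = (\<integral>\<^sup>+y. ennreal (\<rho> (w(i := y))) * f (w(i := y)) \<partial>lborel) *
            ((\<integral>\<^sup>+z. ennreal (\<rho> (w(i := z))) * g (w(i := z)) \<partial>lborel) / ennreal (Z i (w(i := 0))))"
          by (intro nn_integral_multc m f)
        finally show "(\<integral>\<^sup>+y. ennreal (\<rho> (w(i := y))) * f (w(i := y)) * k i (w(i := y)) \<partial>lborel) =
          (\<integral>\<^sup>+y. ennreal (\<rho> (w(i := y))) * f (w(i := y)) \<partial>lborel) *
            (\<integral>\<^sup>+z. ennreal (\<rho> (w(i := z))) * g (w(i := z)) \<partial>lborel) / ennreal (Z i (w(i := 0)))"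
          by (simp add: divide_ennreal_def mult.assoc)
      qed
    qed
    finally show ?thesis .
  qed
  have E_commute: "E i f g = E i g f" for i f g unfolding E_def
    by (intro nn_integral_cong arg_cong2[where f = divide] mult.commute refl)
  show ?thesis
  proof
    fix f g :: "(nat \<Rightarrow> real) \<Rightarrow> ennreal"
    assume fg: "f \<in> borel_measurable \<pi>" "g \<in> borel_measurable \<pi>"
    show "(\<integral>\<^sup>+x. f x * (\<integral>\<^sup>+y. g y \<partial>gibbs_kernel d \<rho> x 1) \<partial>\<pi>) =
      (\<integral>\<^sup>+x. g x * (\<integral>\<^sup>+y. f y \<partial>gibbs_kernel d \<rho> x 1) \<partial>\<pi>)"
      unfolding E[OF fg] E[OF fg(2,1)] by (intro sum.cong refl arg_cong2[where f = times] E_commute)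
  qed
qed

text \<open>Supplies the null point that both inequalities ask for; as \<open>1 \<le> d\<close>, the
  product of the measures of \<open>{0}\<close> has a vanishing factor.\<close>

lemma null_singleton:
  obtains x where "x \<in> space \<pi>" "{x} \<in> sets \<pi>" "measure \<pi> {x} = 0"
proof
  interpret product_sigma_finite "\<lambda>_::nat. lborel :: real measure" by standard
  define x :: "nat \<Rightarrow> real" where "x = (\<lambda>i\<in>{1..d}. 0)"
  have x_eq: "{x} = ({1..d} \<rightarrow>\<^sub>E {0})" by (auto simp: x_def PiE_iff fun_eq_iff extensional_def)
  show "x \<in> space \<pi>" by (auto simp: space_\<pi> space_N x_def)
  have sets: "{x} \<in> sets N" unfolding x_eq lebesgue_Rn_def by (rule sets_PiM_I_finite) auto
  then show "{x} \<in> sets \<pi>" by (simp add: sets_\<pi>)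
  have "emeasure N {x} = (\<Prod>i\<in>{1..d}. emeasure lborel {0::real})"
    unfolding x_eq lebesgue_Rn_def by (rule emeasure_PiM) auto
  also have "\<dots> = 0" using d by simp
  finally have null: "{x} \<in> null_sets N" using sets by auto
  have "AE y in N. y \<in> {x} \<longrightarrow> ennreal (\<rho> y) = 0"
    using AE_not_in[OF null] by (rule eventually_mono) blast
  then have "{x} \<in> null_sets \<pi>"
    unfolding target_def using sets by (subst null_sets_density_iff) auto
  then show "measure \<pi> {x} = 0" by (simp add: measure_def null_setsD1)
qed

end

section \<open>Assembly for the lazy Gibbs sampler and its skeletons\<close>

theorem theorem7p3:
  shows "\<exists>K::real. 0 < K \<and>
    (\<forall>\<alpha>::real. 0 < \<alpha> \<and> \<alpha> < 1 / 2 \<longrightarrow>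
      (\<exists>c c'::real. 0 < c \<and> 0 < c' \<and>
        (\<forall>(d::nat) (\<rho> :: (nat \<Rightarrow> real) \<Rightarrow> real).
          gibbs_density d \<rho> \<and> mixing_time (gibbs_kernel d \<rho>) (target d \<rho>) < \<infinity> \<longrightarrow>
          (let \<pi> = target d \<rho>;
               g\<^sub>L = lazy_kernel \<pi> (gibbs_kernel d \<rho>);
               t\<^sub>L = mixing_time g\<^sub>L \<pi>
           in \<forall>k::nat. real k \<ge> K * real d * ln (real (the_enat t\<^sub>L)) \<longrightarrow>
             (let g\<^sub>L\<^sub>k = skeleton_kernel k g\<^sub>L;
                  T\<^sub>m = mixing_time (lazy_kernel \<pi> g\<^sub>L\<^sub>k) \<pi>;
                  H = max_hitting_time g\<^sub>L\<^sub>k \<pi> \<alpha>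
              in ennreal c * ennreal_of_enat T\<^sub>m \<le> H \<and>
                 H \<le> ennreal c' * (1 + ennreal_of_enat t\<^sub>L / of_nat k))))))"
proof (rule exI[of _ 1], intro conjI allI impI)
  fix \<alpha> :: real assume \<alpha>: "0 < \<alpha> \<and> \<alpha> < 1 / 2"
  \<comment> \<open>The exponent depends on \<alpha> alone, which makes
    \<open>2 * m / \<alpha>\<close> uniform in the dimension and the density. Passing to the
    successor gives \<open>0 < m\<close> and only lowers the power.\<close>
  obtain m0 where m0: "(7 / 8 :: real) ^ m0 < \<alpha> / 2"
    using real_arch_pow_inv[of "\<alpha> / 2" "7 / 8"] \<alpha> by auto
  define m where "m = Suc m0"
  have m: "(7 / 8 :: real) ^ m \<le> \<alpha> / 2" "0 < m"
    using order_trans[OF power_decreasing[of m0 m "7 / 8 :: real"] less_imp_le[OF m0]] by (simp_all add: m_def)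
  have bounds: "ennreal (1 / 55) * ennreal_of_enat (mixing_time (lazy_kernel \<pi> (skeleton_kernel k (lazy_kernel \<pi> (gibbs_kernel d \<rho>)))) \<pi>)
      \<le> max_hitting_time (skeleton_kernel k (lazy_kernel \<pi> (gibbs_kernel d \<rho>))) \<pi> \<alpha>"
    "max_hitting_time (skeleton_kernel k (lazy_kernel \<pi> (gibbs_kernel d \<rho>))) \<pi> \<alpha>
      \<le> ennreal (2 * real m / \<alpha>) * (1 + ennreal_of_enat (mixing_time (lazy_kernel \<pi> (gibbs_kernel d \<rho>)) \<pi>) / of_nat k)"
    if gd: "gibbs_density d \<rho>" and \<pi>: "\<pi> = target d \<rho>" for d k :: nat and \<rho> :: "(nat \<Rightarrow> real) \<Rightarrow> real" and \<pi>
  proof -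
    interpret gibbs d \<rho> by unfold_locales (rule gd)
    \<comment> \<open>Reversibility passes from the sampler to its lazy version and on to the
      skeleton. The lower bound is applied to the skeleton as one-step kernel, the upper bound to
      the lazy sampler.\<close>
    interpret g: reversible_kernel "target d \<rho>" "\<lambda>x. gibbs_kernel d \<rho> x 1" by (rule reversible_gibbs_kernel)
    interpret gL: reversible_kernel "target d \<rho>" g.lazy_step by (rule g.reversible_kernel_lazy_step)
    interpret gLk: reversible_kernel "target d \<rho>" "\<lambda>x. iterate_kernel (target d \<rho>) g.lazy_step x k"
      by (rule gL.reversible_kernel_iterate)
    obtain x0 where x0: "x0 \<in> space (target d \<rho>)" "{x0} \<in> sets (target d \<rho>)" "measure (target d \<rho>) {x0} = 0"
      by (rule null_singleton)
    have lazy: "lazy_kernel (target d \<rho>) (gibbs_kernel d \<rho>) = iterate_kernel (target d \<rho>) g.lazy_step"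
      unfolding lazy_kernel_def g.lazy_step_def[abs_def] ..
    show "ennreal (1 / 55) * ennreal_of_enat (mixing_time (lazy_kernel \<pi> (skeleton_kernel k (lazy_kernel \<pi> (gibbs_kernel d \<rho>)))) \<pi>)
      \<le> max_hitting_time (skeleton_kernel k (lazy_kernel \<pi> (gibbs_kernel d \<rho>))) \<pi> \<alpha>"
      unfolding \<pi> lazy using \<alpha>
      by (intro gLk.mixing_time_lazy_le_max_hitting_time[OF _ _ x0]) (auto simp: skeleton_kernel_def)
    show "max_hitting_time (skeleton_kernel k (lazy_kernel \<pi> (gibbs_kernel d \<rho>))) \<pi> \<alpha>
      \<le> ennreal (2 * real m / \<alpha>) * (1 + ennreal_of_enat (mixing_time (lazy_kernel \<pi> (gibbs_kernel d \<rho>)) \<pi>) / of_nat k)"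
      unfolding \<pi> lazy using \<alpha> by (intro gL.max_hitting_time_skeleton_le[OF _ _ m x0]) auto
  qed
  show "\<exists>c c'::real. 0 < c \<and> 0 < c' \<and>
        (\<forall>(d::nat) (\<rho> :: (nat \<Rightarrow> real) \<Rightarrow> real).
          gibbs_density d \<rho> \<and> mixing_time (gibbs_kernel d \<rho>) (target d \<rho>) < \<infinity> \<longrightarrow>
          (let \<pi> = target d \<rho>;
               g\<^sub>L = lazy_kernel \<pi> (gibbs_kernel d \<rho>);
               t\<^sub>L = mixing_time g\<^sub>L \<pi>
           in \<forall>k::nat. real k \<ge> 1 * real d * ln (real (the_enat t\<^sub>L)) \<longrightarrow>
             (let g\<^sub>L\<^sub>k = skeleton_kernel k g\<^sub>L;
                  T\<^sub>m = mixing_time (lazy_kernel \<pi> g\<^sub>L\<^sub>k) \<pi>;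
                  H = max_hitting_time g\<^sub>L\<^sub>k \<pi> \<alpha>
              in ennreal c * ennreal_of_enat T\<^sub>m \<le> H \<and>
                 H \<le> ennreal c' * (1 + ennreal_of_enat t\<^sub>L / of_nat k))))"
    unfolding Let_def
    by (rule exI[of _ "1 / 55"], rule exI[of _ "2 * real m / \<alpha>"])
       (use \<alpha> m bounds[OF _ refl] in auto)
qed simp

end
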